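(* Let $K$ be a field (with the standing assumption on $\mathrm{char}(K)$ given in the context) and let $I\subset S=K[x_1,\dots,x_n]$ be a nonzero monomial ideal. If $I$ is polymatroidal, or if $I$ is stable (in particular, if $I$ is strongly stable) and all monomials in its minimal monomial generating set have the same degree, then $I$ has differential linear resolution.
   Context: $S=K[x_1,\dots,x_n]$ is the standard graded polynomial ring over the field $K$. For a homogeneous ideal $I\subset S$, the gradient ideal $\partial(I)$ is the ideal generated by all partial derivatives $\partial f/\partial x_i$ ($1\le i\le n$) of the elements $f$ of a minimal generating set of $I$; $\partial^0(I)=I$, $\partial^1(I)=\partial(I)$ and $\partial^\ell(I)=\partial(\partial^{\ell-1}(I))$ for $\ell>1$. For a monomial ideal $I$, $\mathcal{G}(I)$ denotes its minimal monomial generating set, and $\mathrm{supp}(u)=\{i: x_i \text{ divides } u\}$ for a monomial $u$. Standing assumption: $\mathrm{char}(K)=0$, or $\mathrm{char}(K)$ is large enough that for every monomial ideal $I$ under consideration $$\partial(I)=(u/x_i:\ u\in\mathcal{G}(I),\ i\in\mathrm{supp}(u)).$$ For a homogeneous ideal $I$, $\mathrm{reg}\,I=\max\{j-i:\ \dim_K\mathrm{Tor}^S_i(K,I)_j\neq 0\}$ is the Castelnuovo–Mumford regularity, and $\alpha(I)$ is the minimal degree of a minimal homogeneous generator of $I$. The ideal $I$ has linear resolution if all its minimal homogeneous generators have the same degree $d$ and $\mathrm{reg}\,I=d$. A homogeneous ideal $I$ has differential linear resolution if $\partial^\ell(I)$ has linear resolution for all $\ell=0,\dots,\alpha(I)$,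 that is, $\mathrm{reg}\,\partial^\ell(I)=\alpha(I)-\ell$ for all $\ell=0,\dots,\alpha(I)$. For ${\bf a}\in\mathbb{Z}_{\ge0}^n$ put $|{\bf a}|=a_1+\dots+a_n$; vectors are compared componentwise, and ${\bf u}\vee{\bf v}$ is the componentwise maximum. A discrete polymatroid on $[n]=\{1,\dots,n\}$ is a nonempty finite set $P\subset\mathbb{Z}_{\ge0}^n$ such that (1) if ${\bf u}\in P$ and ${\bf v}\in\mathbb{Z}^n_{\ge0}$ with ${\bf v}\le{\bf u}$, then ${\bf v}\in P$; (2) if ${\bf u},{\bf v}\in P$ with $|{\bf u}|<|{\bf v}|$, then there is ${\bf w}\in P$ with ${\bf u}<{\bf w}\le{\bf u}\vee{\bf v}$. The bases of $P$ are its maximal elements. A monomial ideal $I\subset S$ is polymatroidal if the exponent vectors of the monomials in $\mathcal{G}(I)$ form the set of bases of a discrete polymatroid. For a monomial $u\ne1$, $\max(u)=\max\mathrm{supp}(u)$. A monomial ideal $I\subset S$ is stable if for all monomials $u\in I$ with $u\neq1$ and all $i<\max(u)$ one has $x_i(u/x_{\max(u)})\in I$. It is strongly stable if for all monomials $u\in I$ and all $i<j$ with $x_j$ dividing $u$ one has $x_i(u/x_j)\in I$. *)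

theory Defs
  imports "HOL-Library.Poly_Mapping" "HOL-Computational_Algebra.Computational_Algebra"
begin

text \<open>
  The variables are indexed by a finite linearly ordered type \<open>'n\<close>, which stands for
  \<open>1 < \<dots> < n\<close>. Monomials are identified with their exponent vectors, of type
  \<open>'n \<Rightarrow>\<^sub>0 nat\<close>.
\<close>

type_synonym ('n, 'a) mpoly = "('n \<Rightarrow>\<^sub>0 nat) \<Rightarrow>\<^sub>0 'a"

definition mdeg :: "('n::finite \<Rightarrow>\<^sub>0 nat) \<Rightarrow> nat" where
  "mdeg m = (\<Sum>i\<in>UNIV. Poly_Mapping.lookup m i)"

definition monomial :: "('n \<Rightarrow>\<^sub>0 nat) \<Rightarrow> ('n, 'a::comm_ring_1) mpoly" where
  "monomial m = Poly_Mapping.single m 1"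

definition homogeneous :: "nat \<Rightarrow> ('n::finite, 'a::zero) mpoly \<Rightarrow> bool" where
  "homogeneous d f \<longleftrightarrow> (\<forall>m\<in>Poly_Mapping.keys f. mdeg m = d)"

definition partial_deriv :: "'n \<Rightarrow> ('n, 'a::comm_ring_1) mpoly \<Rightarrow> ('n, 'a) mpoly" where
  "partial_deriv i f =
     (\<Sum>m\<in>Poly_Mapping.keys f. Poly_Mapping.single (m - Poly_Mapping.single i 1)
                                     (of_nat (Poly_Mapping.lookup m i) * Poly_Mapping.lookup f m))"


section \<open>Ideals\<close>

lemma module_mult: "module ((*) :: 'r::comm_ring_1 \<Rightarrow> 'r \<Rightarrow> 'r)"
  by unfold_locales (simp_all add: algebra_simps)

definition ideal_gen :: "'r::comm_ring_1 set \<Rightarrow> 'r set" where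
  "ideal_gen A = module.span (*) A"

definition homogeneous_ideal :: "('n::finite, 'a::comm_ring_1) mpoly set \<Rightarrow> bool" where
  "homogeneous_ideal I \<longleftrightarrow> (\<exists>G. (\<forall>f\<in>G. \<exists>d. homogeneous d f) \<and> I = ideal_gen G)"

definition min_hom_gens ::
  "('n::finite, 'a::comm_ring_1) mpoly set \<Rightarrow> ('n, 'a) mpoly set \<Rightarrow> bool" where
  "min_hom_gens I G \<longleftrightarrow>
     (\<forall>f\<in>G. \<exists>d. homogeneous d f) \<and> ideal_gen G = I \<and> (\<forall>H. H \<subset> G \<longrightarrow> ideal_gen H \<noteq> I)"

definition initial_degree :: "('n::finite, 'a::comm_ring_1) mpoly set \<Rightarrow> nat" where
  "initial_degree I = (LEAST d. \<exists>G. min_hom_gens I G \<and> (\<exists>f\<in>G. homogeneous d f))"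

text \<open>The gradient ideal, formed from a chosen minimal homogeneous generating set.\<close>

definition gradient_ideal ::
  "('n::finite, 'a::comm_ring_1) mpoly set \<Rightarrow> ('n, 'a) mpoly set" where
  "gradient_ideal I =
     (let G = (SOME G. min_hom_gens I G) in ideal_gen {partial_deriv i f | i f. f \<in> G})"

definition iter_gradient ::
  "nat \<Rightarrow> ('n::finite, 'a::comm_ring_1) mpoly set \<Rightarrow> ('n, 'a) mpoly set" where
  "iter_gradient l I = (gradient_ideal ^^ l) I"


section \<open>Monomial ideals\<close>

definition monomial_ideal :: "('n, 'a::comm_ring_1) mpoly set \<Rightarrow> bool" where
  "monomial_ideal I \<longleftrightarrow> (\<exists>A. I = ideal_gen (monomial ` A))"

text \<open>The unique minimal monomial generating set, as a set of exponent vectors.\<close>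

definition mon_gens :: "('n, 'a::comm_ring_1) mpoly set \<Rightarrow> ('n \<Rightarrow>\<^sub>0 nat) set" where
  "mon_gens I =
     (THE A. ideal_gen (monomial ` A) = I \<and> (\<forall>B. B \<subset> A \<longrightarrow> ideal_gen (monomial ` B) \<noteq> I))"

text \<open>
  The assumption on the characteristic. The monomial ideals under consideration are the iterated
  gradient ideals that are differentiated again.
\<close>

definition admissible_char :: "('n::finite, 'a::field) mpoly set \<Rightarrow> bool" where
  "admissible_char I \<longleftrightarrow>
     CHAR('a) = 0 \<or>
     (\<forall>l < initial_degree I. let J = iter_gradient l I in
        gradient_ideal J =
          ideal_gen {monomial (u - Poly_Mapping.single i 1) | u i.
                       u \<in> mon_gens J \<and> i \<in> Poly_Mapping.keys u})"

definition stable_ideal :: "('n::{finite,linorder}, 'a::comm_ring_1) mpoly set \<Rightarrow> bool" where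
  "stable_ideal I \<longleftrightarrow> monomial_ideal I \<and>
     (\<forall>u. monomial u \<in> I \<and> u \<noteq> 0 \<longrightarrow> (\<forall>i < Max (Poly_Mapping.keys u).
        monomial (u - Poly_Mapping.single (Max (Poly_Mapping.keys u)) 1 + Poly_Mapping.single i 1) \<in> I))"

definition strongly_stable_ideal ::
  "('n::{finite,linorder}, 'a::comm_ring_1) mpoly set \<Rightarrow> bool" where
  "strongly_stable_ideal I \<longleftrightarrow> monomial_ideal I \<and>
     (\<forall>u i j. monomial u \<in> I \<and> i < j \<and> j \<in> Poly_Mapping.keys u \<longrightarrow>
        monomial (u - Poly_Mapping.single j 1 + Poly_Mapping.single i 1) \<in> I)"

definition equigenerated :: "('n::finite, 'a::comm_ring_1) mpoly set \<Rightarrow> bool" where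
  "equigenerated I \<longleftrightarrow> (\<exists>d. \<forall>u\<in>mon_gens I. mdeg u = d)"

text \<open>Functions are ordered componentwise, and \<open>sup\<close> is the componentwise maximum.\<close>

definition discrete_polymatroid :: "('n::finite \<Rightarrow> nat) set \<Rightarrow> bool" where
  "discrete_polymatroid P \<longleftrightarrow> finite P \<and> P \<noteq> {} \<and>
     (\<forall>u\<in>P. \<forall>v. v \<le> u \<longrightarrow> v \<in> P) \<and>
     (\<forall>u\<in>P. \<forall>v\<in>P. sum u UNIV < sum v UNIV \<longrightarrow> (\<exists>w\<in>P. u < w \<and> w \<le> sup u v))"

definition polymatroid_bases :: "('n \<Rightarrow> nat) set \<Rightarrow> ('n \<Rightarrow> nat) set" where
  "polymatroid_bases P = {u\<in>P. \<not> (\<exists>v\<in>P. u < v)}"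

definition polymatroidal_ideal :: "('n::finite, 'a::comm_ring_1) mpoly set \<Rightarrow> bool" where
  "polymatroidal_ideal I \<longleftrightarrow> monomial_ideal I \<and>
     (\<exists>P. discrete_polymatroid P \<and> Poly_Mapping.lookup ` mon_gens I = polymatroid_bases P)"


section \<open>Tor and regularity\<close>

text \<open>
  Data for an augmented complex \<open>\<dots> \<rightarrow> F\<^sub>1 \<rightarrow> F\<^sub>0 \<rightarrow> K\<close> of graded free modules of finite rank over
  the polynomial ring \<open>S\<close>: \<open>F\<^sub>i\<close> has a basis \<open>(e\<^sub>a)\<close> with \<open>a \<in> gbasis F i\<close>, where \<open>e\<^sub>a\<close> has degree
  \<open>gdeg F i a\<close>; \<open>gdiff F i a b\<close> is the coefficient at \<open>e\<^sub>b \<in> F\<^sub>i\<close> of the image of \<open>e\<^sub>a \<in> F\<^sub>i\<^sub>+\<^sub>1\<close>;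
  and \<open>gaug F a\<close> is the image of \<open>e\<^sub>a \<in> F\<^sub>0\<close> in \<open>K\<close>. An element of \<open>F\<^sub>i\<close> is represented by its
  coefficient function, which vanishes outside \<open>gbasis F i\<close>.
\<close>

record (overloaded) ('n, 'a) graded_free_complex =
  gbasis :: "nat \<Rightarrow> nat set"
  gdeg :: "nat \<Rightarrow> nat \<Rightarrow> int"
  gdiff :: "nat \<Rightarrow> nat \<Rightarrow> nat \<Rightarrow> ('n \<Rightarrow>\<^sub>0 nat) \<Rightarrow>\<^sub>0 'a"
  gaug :: "nat \<Rightarrow> 'a"

definition free_module ::
  "('n, 'a::comm_ring_1) graded_free_complex \<Rightarrow> nat \<Rightarrow> (nat \<Rightarrow> ('n, 'a) mpoly) set" where
  "free_module F i = {v. \<forall>a. a \<notin> gbasis F i \<longrightarrow> v a = 0}"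

definition bd :: "('n, 'a::comm_ring_1) graded_free_complex \<Rightarrow> nat \<Rightarrow>
    (nat \<Rightarrow> ('n, 'a) mpoly) \<Rightarrow> (nat \<Rightarrow> ('n, 'a) mpoly)" where
  "bd F i v = (\<lambda>b. if b \<in> gbasis F i then \<Sum>a\<in>gbasis F (Suc i). v a * gdiff F i a b else 0)"

text \<open>\<open>S\<close> acts on \<open>K = S/(x\<^sub>1,\<dots>,x\<^sub>n)\<close> through the constant coefficient.\<close>

definition augmentation ::
  "('n, 'a::comm_ring_1) graded_free_complex \<Rightarrow> (nat \<Rightarrow> ('n, 'a) mpoly) \<Rightarrow> 'a" where
  "augmentation F v = (\<Sum>a\<in>gbasis F 0. Poly_Mapping.lookup (v a) 0 * gaug F a)"

definition graded_free_resolution :: "('n::finite, 'a::comm_ring_1) graded_free_complex \<Rightarrow> bool" where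
  "graded_free_resolution F \<longleftrightarrow>
     (\<forall>i. finite (gbasis F i)) \<and>
     (\<forall>i. \<forall>a\<in>gbasis F (Suc i). \<forall>b\<in>gbasis F i. \<forall>m\<in>Poly_Mapping.keys (gdiff F i a b).
        int (mdeg m) + gdeg F i b = gdeg F (Suc i) a) \<and>
     (\<forall>a\<in>gbasis F 0. gaug F a \<noteq> 0 \<longrightarrow> gdeg F 0 a = 0) \<and>
     augmentation F ` free_module F 0 = UNIV \<and>
     {v \<in> free_module F 0. augmentation F v = 0} = bd F 0 ` free_module F 1 \<and>
     (\<forall>i. {v \<in> free_module F (Suc i). bd F i v = (\<lambda>_. 0)} =
          bd F (Suc i) ` free_module F (Suc (Suc i)))"

definition residue_field_resolution :: "('n::finite, 'a::comm_ring_1) graded_free_complex" where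
  "residue_field_resolution = (SOME F. graded_free_resolution F)"

text \<open>
  The degree \<open>j\<close> component of \<open>F\<^sub>i \<otimes>\<^sub>S I\<close>. As \<open>F\<^sub>i\<close> is free, \<open>F\<^sub>i \<otimes>\<^sub>S I\<close> is the direct sum of copies of
  \<open>I\<close> indexed by the basis, with \<open>e\<^sub>a \<otimes> f\<close> in degree \<open>gdeg F i a + deg f\<close>, and the differential
  of \<open>F \<otimes>\<^sub>S I\<close> is again given by \<open>gdiff\<close>.
\<close>

definition tensor_chains :: "('n::finite, 'a::comm_ring_1) graded_free_complex \<Rightarrow>
    ('n, 'a) mpoly set \<Rightarrow> nat \<Rightarrow> int \<Rightarrow> (nat \<Rightarrow> ('n, 'a) mpoly) set" where
  "tensor_chains F I i j = {v \<in> free_module F i.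
     \<forall>a\<in>gbasis F i. v a \<in> I \<and> (\<forall>m\<in>Poly_Mapping.keys (v a). int (mdeg m) + gdeg F i a = j)}"

fun tensor_cycles :: "('n::finite, 'a::comm_ring_1) graded_free_complex \<Rightarrow>
    ('n, 'a) mpoly set \<Rightarrow> nat \<Rightarrow> int \<Rightarrow> (nat \<Rightarrow> ('n, 'a) mpoly) set" where
  "tensor_cycles F I 0 j = tensor_chains F I 0 j"
| "tensor_cycles F I (Suc i) j = {v \<in> tensor_chains F I (Suc i) j. bd F i v = (\<lambda>_. 0)}"

definition tensor_boundaries :: "('n::finite, 'a::comm_ring_1) graded_free_complex \<Rightarrow>
    ('n, 'a) mpoly set \<Rightarrow> nat \<Rightarrow> int \<Rightarrow> (nat \<Rightarrow> ('n, 'a) mpoly) set" where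
  "tensor_boundaries F I i j = bd F i ` tensor_chains F I (Suc i) j"

text \<open>
  \<open>Tor\<^sub>i(K,I)\<^sub>j\<close> as the quotient of cycles by boundaries; its zero element is the coset of
  boundaries, so \<open>Tor\<^sub>i(K,I)\<^sub>j\<close> has nonzero dimension iff it is not the singleton of that coset.
\<close>

definition Tor :: "nat \<Rightarrow> ('n::finite, 'a::comm_ring_1) mpoly set \<Rightarrow> int \<Rightarrow>
    (nat \<Rightarrow> ('n, 'a) mpoly) set set" where
  "Tor i I j = (let F = residue_field_resolution; B = tensor_boundaries F I i j in
     (\<lambda>z. (\<lambda>b a. z a + b a) ` B) ` tensor_cycles F I i j)"

definition Tor_nonzero :: "nat \<Rightarrow> ('n::finite, 'a::comm_ring_1) mpoly set \<Rightarrow> int \<Rightarrow> bool" where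
  "Tor_nonzero i I j \<longleftrightarrow> Tor i I j \<noteq> {tensor_boundaries residue_field_resolution I i j}"

definition reg :: "('n::finite, 'a::comm_ring_1) mpoly set \<Rightarrow> int" where
  "reg I = Max {j - int i | i j. Tor_nonzero i I j}"

definition linear_resolution :: "('n::finite, 'a::comm_ring_1) mpoly set \<Rightarrow> bool" where
  "linear_resolution I \<longleftrightarrow>
     (\<exists>d. (\<forall>G. min_hom_gens I G \<longrightarrow> (\<forall>f\<in>G. homogeneous d f)) \<and> reg I = int d)"

definition differential_linear_resolution ::
  "('n::finite, 'a::comm_ring_1) mpoly set \<Rightarrow> bool" where
  "differential_linear_resolution I \<longleftrightarrow> homogeneous_ideal I \<and>
     (\<forall>l \<le> initial_degree I. linear_resolution (iter_gradient l I) \<and>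
        reg (iter_gradient l I) = int (initial_degree I) - int l)"

end

theory Submission
  imports Defs
begin

text \<open>
  Two properties of a finite set \<open>A\<close> of monomials of degree \<open>d\<close> are in play: closure under the
  replacement of the last variable of a monomial by an earlier one (stability), and being the set of
  all vectors of size \<open>d\<close> in a discrete polymatroid. Each is inherited by
  \<open>{u / x\<^sub>i | u \<in> A, x\<^sub>i divides u}\<close>: for stability by a case distinction on whether \<open>x\<^sub>i\<close> lies beyond
  the last variable of the quotient (\<open>stable_gradient\<close>), for polymatroids because the quotients are
  exactly the vectors of size \<open>d - 1\<close> (\<open>truncation_gradient\<close>). These quotients generate the gradient
  ideal: in characteristic zero every minimal homogeneous generating set spans the same space of forms
  of degree \<open>d\<close> as \<open>A\<close> does (\<open>gradient_ideal_char_0\<close>), and in positive characteristic this is the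
  hypothesis. So it suffices that the ideal generated by a set \<open>A\<close> of either kind has regularity
  \<open>d\<close>.

  Ordered lexicographically, largest first, either kind of set has linear quotients: the ideal of the
  generators before \<open>u\<close>, divided by \<open>u\<close>, is generated by variables (\<open>stable_linear_quotients\<close>,
  \<open>truncation_linear_quotients\<close>). Each step of the resulting filtration is then a copy of
  \<open>S/(x\<^sub>c | c \<in> C)\<close> shifted by \<open>d\<close>, and \<open>Tor\<^sub>i(K, S/(x\<^sub>c | c \<in> C))\<close> is concentrated in degree \<open>i\<close>, by
  induction on \<open>C\<close>. The long exact sequences of \<open>Tor\<close> give \<open>Tor\<^sub>i(K, I)\<^sub>j = 0\<close> unless \<open>j = i + d\<close>
  (\<open>rel_acyclic_linear_quotients\<close>), and a generator of \<open>I\<close> represents a nonzero class in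
  \<open>Tor\<^sub>0(K, I)\<^sub>d\<close> (\<open>Tor_nonzero_generator\<close>).

  \<open>Tor\<close> is formed from an unspecified graded free resolution \<open>F\<close> of \<open>K\<close>. All vanishing arguments
  therefore run inside an arbitrary \<open>F\<close>, for subquotients \<open>M/N\<close> of \<open>S\<close> and directly on cycles
  representing homology classes of \<open>F \<otimes> M/N\<close>; they use the exactness of \<open>F\<close> only to know
  \<open>Tor\<^sub>i(K, S)\<close>. That some \<open>F\<close> exists is shown by building the Koszul complex as an iterated mapping
  cone (\<open>residue_field_resolution_is_resolution\<close>).
\<close>

section \<open>Spans of monomials\<close>

abbreviation "lookup \<equiv> Poly_Mapping.lookup"
abbreviation "keys \<equiv> Poly_Mapping.keys"
abbreviation "single \<equiv> Poly_Mapping.single"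

text \<open>
  For an up-closed \<open>M\<close> this is the monomial ideal whose monomials are those of \<open>M\<close>; sums and colons of
  monomial ideals become set operations on \<open>M\<close>.
\<close>

definition mon_span :: "('n \<Rightarrow>\<^sub>0 nat) set \<Rightarrow> ('n, 'a::comm_ring_1) mpoly set" where
  "mon_span M = {f. keys f \<subseteq> M}"

definition up :: "('n \<Rightarrow>\<^sub>0 nat) set \<Rightarrow> ('n \<Rightarrow>\<^sub>0 nat) set" where
  "up A = {a + c | a c. a \<in> A}"

definition up_closed :: "('n \<Rightarrow>\<^sub>0 nat) set \<Rightarrow> bool" where
  "up_closed M \<longleftrightarrow> (\<forall>m\<in>M. \<forall>c. m + c \<in> M)"

lemma up_closed_up: "up_closed (up A)"
  unfolding up_closed_def up_def by (force simp: add.assoc)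

lemma up_superset: "A \<subseteq> up A"
  unfolding up_def by (force intro: exI[of _ 0])

lemma up_least: "A \<subseteq> M \<Longrightarrow> up_closed M \<Longrightarrow> up A \<subseteq> M"
  unfolding up_def up_closed_def by auto

lemma up_Un: "up (A \<union> B) = up A \<union> up B"
  unfolding up_def by auto

lemma mon_le_iff_add:
  fixes a m :: "'n \<Rightarrow>\<^sub>0 nat"
  shows "(\<exists>c. m = a + c) \<longleftrightarrow> (\<forall>i. lookup a i \<le> lookup m i)"
proof
  assume "\<forall>i. lookup a i \<le> lookup m i"
  then have "m = a + (m - a)"
    by (intro poly_mapping_eqI) (simp add: lookup_add lookup_minus)
  then show "\<exists>c. m = a + c" ..
qed (auto simp: lookup_add)

lemma mem_up_iff: "m \<in> up A \<longleftrightarrow> (\<exists>a\<in>A. \<forall>i. lookup a i \<le> lookup m i)"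
  unfolding up_def mon_le_iff_add[symmetric] by auto

lemma mdeg_add: "mdeg (a + b) = mdeg a + mdeg b"
  by (simp add: mdeg_def lookup_add sum.distrib)

lemma mdeg_single: "mdeg (single i k) = k"
  by (simp add: mdeg_def lookup_single when_def)

lemma mdeg_eq_0_iff: "mdeg m = 0 \<longleftrightarrow> m = 0"
  by (auto simp: mdeg_def intro: poly_mapping_eqI)

lemma mon_le_same_degree_eqI:
  fixes a m :: "'n::finite \<Rightarrow>\<^sub>0 nat"
  assumes "\<And>i. lookup a i \<le> lookup m i" "mdeg a = mdeg m"
  shows "a = m"
proof -
  obtain c where c: "m = a + c" using assms(1) mon_le_iff_add by blast
  then have "mdeg c = 0" using assms(2) by (simp add: mdeg_add)
  then show ?thesis using c by (simp add: mdeg_eq_0_iff)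
qed

lemma poly_sum_monomials:
  "f = (\<Sum>m\<in>keys f. single m (lookup f m))"
  by (rule poly_mapping_eqI) (auto simp: lookup_sum lookup_single when_def in_keys_iff)

lemma lookup_single_mult:
  fixes f :: "('n, 'a::comm_ring_1) mpoly"
  shows "lookup (single u c * f) m =
    (if \<exists>k. m = u + k then c * lookup f (m - u) else 0)"
proof -
  have "single u c * f =
      (\<Sum>k\<in>keys f. single (u + k) (c * lookup f k))"
    by (subst poly_sum_monomials[of f], simp add: sum_distrib_left mult_single)
  then have "lookup (single u c * f) m =
      (\<Sum>k\<in>keys f. if u + k = m then c * lookup f k else 0)"
    by (simp add: lookup_sum lookup_single when_def)
  also have "\<dots> = (if \<exists>k. m = u + k then c * lookup f (m - u) else 0)"
  proof (cases "\<exists>k. m = u + k")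
    case True
    then obtain k where k: "m = u + k" ..
    have "(\<Sum>k'\<in>keys f. if u + k' = m then c * lookup f k' else 0)
        = (\<Sum>k'\<in>keys f. if k' = k then c * lookup f k' else 0)"
      by (simp add: k)
    then show ?thesis using k by (auto simp: in_keys_iff)
  next
    case False
    then have "\<And>k. u + k \<noteq> m" by blast
    then show ?thesis using False by simp
  qed
  finally show ?thesis .
qed

lemma lookup_monomial_mult_add [simp]:
  "lookup (monomial u * f) (u + m) = lookup f m"
  by (auto simp: monomial_def lookup_single_mult)

lemma keys_monomial_mult: "keys (monomial u * f) = (+) u ` keys f"
  by (auto simp: monomial_def lookup_single_mult in_keys_iff split: if_splits)

lemma keys_monomial [simp]: "keys (monomial u :: ('n, 'a::comm_ring_1) mpoly) = {u}"
  by (simp add: monomial_def)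

lemma monomial_in_mon_span [simp]:
  "(monomial u :: ('n, 'a::comm_ring_1) mpoly) \<in> mon_span M \<longleftrightarrow> u \<in> M"
  by (simp add: mon_span_def)

lemma mon_span_inject:
  "(mon_span M :: ('n, 'a::comm_ring_1) mpoly set) = mon_span N \<longleftrightarrow> M = N"
  by (metis monomial_in_mon_span set_eqI)

lemma mon_span_0 [simp]: "0 \<in> mon_span M"
  by (simp add: mon_span_def)

lemma mon_span_add: "f \<in> mon_span M \<Longrightarrow> g \<in> mon_span M \<Longrightarrow> f + g \<in> mon_span M"
  unfolding mon_span_def using keys_add[of f g] by blast

lemma mon_span_mult:
  assumes "up_closed M" "f \<in> mon_span M"
  shows "r * f \<in> mon_span M"
proof -
  have "a + b \<in> M" if "b \<in> keys f" for a b
    using assms that unfolding mon_span_def up_closed_def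
    by (metis (mono_tags) add.commute mem_Collect_eq subsetD)
  then show ?thesis
    unfolding mon_span_def using keys_mult[of r f] by blast
qed

lemma ideal_gen_least:
  assumes "A \<subseteq> J" "0 \<in> J" "\<And>f g. f \<in> J \<Longrightarrow> g \<in> J \<Longrightarrow> f + g \<in> J"
    "\<And>r f. f \<in> J \<Longrightarrow> r * f \<in> J"
  shows "ideal_gen A \<subseteq> J"
proof -
  interpret module "(*) :: 'a \<Rightarrow> 'a \<Rightarrow> 'a" by (rule module_mult)
  show ?thesis
    unfolding ideal_gen_def using assms by (intro span_minimal) (auto simp: subspace_def)
qed

lemma ideal_gen_base: "A \<subseteq> ideal_gen A"
  unfolding ideal_gen_def using module.span_superset[OF module_mult] .

lemma ideal_gen_mult: "f \<in> ideal_gen A \<Longrightarrow> r * f \<in> ideal_gen A"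
  unfolding ideal_gen_def using module.span_scale[OF module_mult] .

lemma ideal_gen_add: "f \<in> ideal_gen A \<Longrightarrow> g \<in> ideal_gen A \<Longrightarrow> f + g \<in> ideal_gen A"
  unfolding ideal_gen_def using module.span_add[OF module_mult] .

lemma ideal_gen_0: "0 \<in> ideal_gen A"
  unfolding ideal_gen_def using module.span_zero[OF module_mult] .

lemma ideal_gen_sum: "(\<And>x. x \<in> X \<Longrightarrow> f x \<in> ideal_gen A) \<Longrightarrow> sum f X \<in> ideal_gen A"
  unfolding ideal_gen_def using module.span_sum[OF module_mult, of X f A] by blast

lemma ideal_gen_subset: "A \<subseteq> ideal_gen B \<Longrightarrow> ideal_gen A \<subseteq> ideal_gen B"
  by (rule ideal_gen_least) (auto intro: ideal_gen_mult ideal_gen_add ideal_gen_0)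

lemma ideal_gen_monomials:
  "ideal_gen (monomial ` A) = (mon_span (up A) :: ('n, 'a::comm_ring_1) mpoly set)"
proof
  show "ideal_gen (monomial ` A) \<subseteq> (mon_span (up A) :: ('n, 'a) mpoly set)"
  proof (rule ideal_gen_least)
    show "monomial ` A \<subseteq> (mon_span (up A) :: ('n, 'a) mpoly set)"
      using up_superset[of A] by auto
  qed (auto intro: mon_span_add mon_span_mult up_closed_up)
  show "(mon_span (up A) :: ('n, 'a) mpoly set) \<subseteq> ideal_gen (monomial ` A)"
  proof
    fix f :: "('n, 'a) mpoly"
    assume f: "f \<in> mon_span (up A)"
    have "single m (lookup f m) \<in> ideal_gen (monomial ` A)"
      if "m \<in> keys f" for m
    proof -
      have "m \<in> up A" using f that by (auto simp: mon_span_def)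
      then obtain a c where "a \<in> A" "m = a + c" unfolding up_def by blast
      then have "single m (lookup f m) = single c (lookup f m) * monomial a"
        by (simp add: monomial_def mult_single add.commute)
      moreover have "(monomial a :: ('n, 'a) mpoly) \<in> ideal_gen (monomial ` A)"
        using subsetD[OF ideal_gen_base imageI[OF \<open>a \<in> A\<close>]] .
      ultimately show ?thesis by (simp add: ideal_gen_mult)
    qed
    then have "(\<Sum>m\<in>keys f. single m (lookup f m)) \<in> ideal_gen (monomial ` A)"
      by (rule ideal_gen_sum)
    then show "f \<in> ideal_gen (monomial ` A)"
      by (simp add: poly_sum_monomials[symmetric])
  qed
qed

text \<open>
  Homogeneous components are the case where \<open>P\<close> prescribes the degree.
\<close>

definition trunc :: "('k \<Rightarrow> bool) \<Rightarrow> ('k \<Rightarrow>\<^sub>0 'a::comm_ring_1) \<Rightarrow> 'k \<Rightarrow>\<^sub>0 'a" where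
  "trunc P f = (\<Sum>m\<in>{m \<in> keys f. P m}. single m (lookup f m))"

lemma lookup_trunc: "lookup (trunc P f) m = (if P m then lookup f m else 0)"
  by (auto simp: trunc_def lookup_sum lookup_single when_def in_keys_iff)

lemma keys_trunc: "keys (trunc P f) = {m \<in> keys f. P m}"
  by (auto simp: in_keys_iff lookup_trunc split: if_splits)

lemma trunc_add: "trunc P (f + g) = trunc P f + trunc P g"
  by (rule poly_mapping_eqI) (simp add: lookup_trunc lookup_add)

section \<open>Vanishing of Tor for subquotients of the polynomial ring\<close>

lemma keys_diff_subset: "keys (f - g) \<subseteq> keys f \<union> keys (g :: 'k \<Rightarrow>\<^sub>0 'a::ab_group_add)"
  by (auto simp: in_keys_iff lookup_minus)

lemma bd_diff: "bd F i (\<lambda>a. v a - w a) = (\<lambda>b. bd F i v b - bd F i w b)"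
  by (auto simp: bd_def left_diff_distrib sum_subtractf)

lemma bd_add: "bd F i (\<lambda>a. v a + w a) = (\<lambda>b. bd F i v b + bd F i w b)"
  by (auto simp: bd_def distrib_right sum.distrib)

lemma bd_mult: "bd F i (\<lambda>a. r * v a) = (\<lambda>b. r * bd F i v b)"
  by (auto simp: bd_def sum_distrib_left mult.assoc)

lemma bd_zero: "bd F i (\<lambda>a. 0) = (\<lambda>b. 0)"
  by (auto simp: bd_def)

lemma free_module_key: "v \<in> free_module F i \<Longrightarrow> m \<in> keys (v a) \<Longrightarrow> a \<in> gbasis F i"
  unfolding free_module_def by (metis (mono_tags, lifting) empty_iff keys_zero mem_Collect_eq)

lemma bd_free: "bd F i v \<in> free_module F i"
  by (simp add: bd_def free_module_def)

text \<open>
  The quotient of \<open>f\<close> on division by the monomial \<open>u\<close>. It is a polynomial because \<open>(+) u\<close> is injective.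
\<close>

definition mon_quot :: "('n \<Rightarrow>\<^sub>0 nat) \<Rightarrow> ('n, 'a::comm_ring_1) mpoly \<Rightarrow> ('n, 'a) mpoly" where
  "mon_quot u f = Poly_Mapping.map_key ((+) u) f"

lemma lookup_mon_quot: "lookup (mon_quot u f) m = lookup f (u + m)"
  by (simp add: mon_quot_def map_key.rep_eq)

lemma mon_quot_remainder:
  assumes m: "m \<in> keys (f - monomial u * mon_quot u f)"
  shows "m \<in> keys f" "\<not> (\<exists>c. m = u + c)"
proof -
  show nu: "\<not> (\<exists>c. m = u + c)"
  proof
    assume "\<exists>c. m = u + c"
    then obtain c where "m = u + c" ..
    then have "lookup (f - monomial u * mon_quot u f) m = 0"
      by (simp add: lookup_minus lookup_mon_quot)
    then show False using m by (simp add: in_keys_iff)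
  qed
  then show "m \<in> keys f"
    using subsetD[OF keys_diff_subset m] unfolding keys_monomial_mult by blast
qed

context
  fixes F :: "('n::finite, 'a::comm_ring_1) graded_free_complex"
begin

definition chains :: "('n \<Rightarrow>\<^sub>0 nat) set \<Rightarrow> nat \<Rightarrow> int \<Rightarrow> (nat \<Rightarrow> ('n, 'a) mpoly) set" where
  "chains M = tensor_chains F (mon_span M)"

text \<open>
  The homology of \<open>F \<otimes> (M/N)\<close> vanishes in homological degree \<open>i\<close> and internal degree \<open>j\<close>. Cycles and
  boundaries modulo \<open>N\<close> are represented by chains with coefficients in \<open>M\<close>, which avoids quotient
  modules.
\<close>

definition rel_acyclic ::
  "('n \<Rightarrow>\<^sub>0 nat) set \<Rightarrow> ('n \<Rightarrow>\<^sub>0 nat) set \<Rightarrow> nat \<Rightarrow> int \<Rightarrow> bool" where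
  "rel_acyclic M N i j \<longleftrightarrow>
     (\<forall>v\<in>chains M i j. (\<forall>k. i = Suc k \<longrightarrow> bd F k v \<in> chains N k j) \<longrightarrow>
        (\<exists>w\<in>chains M (Suc i) j. (\<lambda>a. v a - bd F i w a) \<in> chains N i j))"

text \<open>
  A coefficient vanishes iff it has no keys, so even membership in the free module is a condition on terms.
\<close>

lemma mem_chains_iff:
  "v \<in> chains M i j \<longleftrightarrow>
     (\<forall>a. \<forall>m\<in>keys (v a). a \<in> gbasis F i \<and> m \<in> M \<and> int (mdeg m) + gdeg F i a = j)"
proof
  assume v: "v \<in> chains M i j"
  show "\<forall>a. \<forall>m\<in>keys (v a). a \<in> gbasis F i \<and> m \<in> M \<and> int (mdeg m) + gdeg F i a = j"
  proof (intro allI ballI)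
    fix a m assume m: "m \<in> keys (v a)"
    have "a \<in> gbasis F i"
    proof (rule ccontr)
      assume "a \<notin> gbasis F i"
      then have "v a = 0" using v by (simp add: chains_def tensor_chains_def free_module_def)
      then show False using m by simp
    qed
    then show "a \<in> gbasis F i \<and> m \<in> M \<and> int (mdeg m) + gdeg F i a = j"
      using v m by (auto simp: chains_def tensor_chains_def mon_span_def)
  qed
next
  assume R: "\<forall>a. \<forall>m\<in>keys (v a). a \<in> gbasis F i \<and> m \<in> M \<and> int (mdeg m) + gdeg F i a = j"
  have "v a = 0" if "a \<notin> gbasis F i" for a
  proof -
    have "keys (v a) = {}" using R that by blast
    then show ?thesis by simp
  qed
  then show "v \<in> chains M i j"
    using R by (auto simp: chains_def tensor_chains_def free_module_def mon_span_def)
qed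

lemma chains_free: "v \<in> chains M i j \<Longrightarrow> v \<in> free_module F i"
  by (simp add: chains_def tensor_chains_def)

lemma chains_mono: "v \<in> chains N i j \<Longrightarrow> N \<subseteq> M \<Longrightarrow> v \<in> chains M i j"
  unfolding mem_chains_iff by blast

lemma chains_diff:
  assumes "v \<in> chains M i j" "w \<in> chains M i j"
  shows "(\<lambda>a. v a - w a) \<in> chains M i j"
  unfolding mem_chains_iff
proof (intro allI ballI)
  fix a m assume "m \<in> keys (v a - w a)"
  then have "m \<in> keys (v a) \<or> m \<in> keys (w a)" using keys_diff_subset[of "v a" "w a"] by blast
  then show "a \<in> gbasis F i \<and> m \<in> M \<and> int (mdeg m) + gdeg F i a = j"
    using assms unfolding mem_chains_iff by blast
qed

lemma chains_add:
  assumes "v \<in> chains M i j" "w \<in> chains M i j"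
  shows "(\<lambda>a. v a + w a) \<in> chains M i j"
  unfolding mem_chains_iff
proof (intro allI ballI)
  fix a m assume "m \<in> keys (v a + w a)"
  then have "m \<in> keys (v a) \<or> m \<in> keys (w a)" using keys_add[of "v a" "w a"] by blast
  then show "a \<in> gbasis F i \<and> m \<in> M \<and> int (mdeg m) + gdeg F i a = j"
    using assms unfolding mem_chains_iff by blast
qed

context
  assumes res: "graded_free_resolution F"
begin

lemma res_exact:
  "{v \<in> free_module F (Suc i). bd F i v = (\<lambda>_. 0)} = bd F (Suc i) ` free_module F (Suc (Suc i))"
  using res by (simp add: graded_free_resolution_def)

lemma res_exact_0: "{v \<in> free_module F 0. augmentation F v = 0} = bd F 0 ` free_module F 1"
  using res by (simp add: graded_free_resolution_def)

lemma res_degree: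
  "a \<in> gbasis F (Suc i) \<Longrightarrow> b \<in> gbasis F i \<Longrightarrow> m \<in> keys (gdiff F i a b) \<Longrightarrow>
     int (mdeg m) + gdeg F i b = gdeg F (Suc i) a"
  using res by (simp add: graded_free_resolution_def)

lemma res_aug_degree: "a \<in> gbasis F 0 \<Longrightarrow> gaug F a \<noteq> 0 \<Longrightarrow> gdeg F 0 a = 0"
  using res by (simp add: graded_free_resolution_def)

lemma bd_bd: "w \<in> free_module F (Suc (Suc i)) \<Longrightarrow> bd F i (bd F (Suc i) w) = (\<lambda>_. 0)"
  using res_exact by blast

lemma bd_key:
  assumes m: "m \<in> keys (bd F i v b)"
  obtains a k l where "a \<in> gbasis F (Suc i)" "b \<in> gbasis F i" "k \<in> keys (v a)"
    "m = k + l" "int (mdeg l) + gdeg F i b = gdeg F (Suc i) a"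
proof -
  have b: "b \<in> gbasis F i" using m by (auto simp: bd_def split: if_splits)
  then have "m \<in> keys (\<Sum>a\<in>gbasis F (Suc i). v a * gdiff F i a b)"
    using m by (simp add: bd_def)
  then obtain a where a: "a \<in> gbasis F (Suc i)" "m \<in> keys (v a * gdiff F i a b)"
    using subsetD[OF keys_sum] by fast
  then obtain k l where kl: "k \<in> keys (v a)" "l \<in> keys (gdiff F i a b)" "m = k + l"
    using keys_mult[of "v a" "gdiff F i a b"] by blast
  then have "int (mdeg l) + gdeg F i b = gdeg F (Suc i) a"
    using res_degree a b by blast
  then show ?thesis using that a b kl by blast
qed

lemma bd_chains:
  assumes "v \<in> chains M (Suc i) j" "up_closed M"
  shows "bd F i v \<in> chains M i j"
  unfolding mem_chains_iff
proof (intro allI ballI)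
  fix b m assume "m \<in> keys (bd F i v b)"
  then obtain a k l where *: "a \<in> gbasis F (Suc i)" "b \<in> gbasis F i" "k \<in> keys (v a)"
    "m = k + l" "int (mdeg l) + gdeg F i b = gdeg F (Suc i) a"
    by (rule bd_key)
  then have "k \<in> M" "int (mdeg k) + gdeg F (Suc i) a = j"
    using assms(1) unfolding mem_chains_iff by blast+
  then show "b \<in> gbasis F i \<and> m \<in> M \<and> int (mdeg m) + gdeg F i b = j"
    using * assms(2) unfolding up_closed_def by (auto simp: mdeg_add)
qed

text \<open>
  The part \<open>Tor\<^sub>i(N/L) \<rightarrow> Tor\<^sub>i(M/L) \<rightarrow> Tor\<^sub>i(M/N)\<close> of a long exact sequence: a cycle of \<open>M/L\<close> bounds
  modulo \<open>N\<close>, and what remains is a cycle of \<open>N/L\<close>.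
\<close>

lemma rel_acyclic_trans:
  assumes "rel_acyclic N L i j" "rel_acyclic M N i j" "N \<subseteq> M" "L \<subseteq> N"
  shows "rel_acyclic M L i j"
  unfolding rel_acyclic_def
proof (intro ballI impI)
  fix v assume v: "v \<in> chains M i j" "\<forall>k. i = Suc k \<longrightarrow> bd F k v \<in> chains L k j"
  then have "\<forall>k. i = Suc k \<longrightarrow> bd F k v \<in> chains N k j" using chains_mono assms by blast
  then obtain w where w: "w \<in> chains M (Suc i) j" "(\<lambda>a. v a - bd F i w a) \<in> chains N i j"
    using assms(2) v(1) unfolding rel_acyclic_def by blast
  have "bd F k (\<lambda>a. v a - bd F i w a) \<in> chains L k j" if "i = Suc k" for k
    using v(2) that bd_bd[OF chains_free[OF w(1)[unfolded that]]] by (simp add: bd_diff)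
  then obtain z where z: "z \<in> chains N (Suc i) j"
      "(\<lambda>a. (v a - bd F i w a) - bd F i z a) \<in> chains L i j"
    using assms(1) w(2) unfolding rel_acyclic_def by blast
  have "(\<lambda>a. w a + z a) \<in> chains M (Suc i) j"
    using chains_add w(1) chains_mono[OF z(1) assms(3)] by blast
  moreover have "(\<lambda>a. v a - bd F i (\<lambda>a. w a + z a) a) \<in> chains L i j"
    using z(2) by (simp add: bd_add diff_diff_add)
  ultimately show "\<exists>w\<in>chains M (Suc i) j. (\<lambda>a. v a - bd F i w a) \<in> chains L i j" by blast
qed

text \<open>
  The part \<open>Tor\<^sub>i(M/L) \<rightarrow> Tor\<^sub>i(M/N) \<rightarrow> Tor\<^sub>i\<^sub>-\<^sub>1(N/L)\<close> of a long exact sequence: the boundary of a cycle of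
  \<open>M/N\<close> is a cycle of \<open>N/L\<close>, so correcting by a chain of \<open>N\<close> yields a cycle of \<open>M/L\<close>.
\<close>

lemma rel_acyclic_quotient:
  assumes whole: "rel_acyclic M L i j" and sub: "\<And>k. i = Suc k \<Longrightarrow> rel_acyclic N L k j"
    and "L \<subseteq> N" "N \<subseteq> M"
  shows "rel_acyclic M N i j"
  unfolding rel_acyclic_def
proof (intro ballI impI)
  fix v assume v: "v \<in> chains M i j" "\<forall>k. i = Suc k \<longrightarrow> bd F k v \<in> chains N k j"
  have "\<exists>w\<in>chains N i j. \<forall>k. i = Suc k \<longrightarrow> bd F k (\<lambda>a. v a - w a) \<in> chains L k j"
  proof (cases i)
    case 0
    have "(\<lambda>a. 0) \<in> chains N i j" by (simp add: mem_chains_iff)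
    then show ?thesis using 0 by blast
  next
    case (Suc k)
    have "bd F l (bd F k v) \<in> chains L l j" if "k = Suc l" for l
      using bd_bd[OF chains_free[OF v(1)[unfolded Suc that]]] that by (simp add: mem_chains_iff)
    then show ?thesis
      using sub[OF Suc] v(2) Suc unfolding rel_acyclic_def by (auto simp: bd_diff)
  qed
  then obtain w where w: "w \<in> chains N i j"
    "\<forall>k. i = Suc k \<longrightarrow> bd F k (\<lambda>a. v a - w a) \<in> chains L k j" by blast
  have "(\<lambda>a. v a - w a) \<in> chains M i j"
    using chains_diff v(1) chains_mono[OF w(1) assms(4)] by blast
  then obtain z where z: "z \<in> chains M (Suc i) j" "(\<lambda>a. (v a - w a) - bd F i z a) \<in> chains L i j"
    using whole w(2) unfolding rel_acyclic_def by blast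
  have "(\<lambda>a. ((v a - w a) - bd F i z a) + w a) \<in> chains N i j"
    using chains_add[OF chains_mono[OF z(2) assms(3)] w(1)] .
  then have "(\<lambda>a. v a - bd F i z a) \<in> chains N i j" by (simp add: algebra_simps)
  then show "\<exists>w\<in>chains M (Suc i) j. (\<lambda>a. v a - bd F i w a) \<in> chains N i j" using z(1) by blast
qed

text \<open>
  Multiplication by \<open>x\<^sup>u\<close> is an isomorphism from \<open>S/(N : x\<^sup>u)\<close>, shifted by the degree of \<open>u\<close>, onto
  \<open>(N + (x\<^sup>u))/N\<close>. On chains its inverse is division by \<open>x\<^sup>u\<close>, whose remainder lies in \<open>N\<close>.
\<close>

lemma rel_acyclic_shift:
  assumes "rel_acyclic UNIV {m. u + m \<in> N} i (j - int (mdeg u))" "up_closed N"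
  shows "rel_acyclic (N \<union> up {u}) N i j"
  unfolding rel_acyclic_def
proof (intro ballI impI)
  fix v assume v: "v \<in> chains (N \<union> up {u}) i j"
    "\<forall>k. i = Suc k \<longrightarrow> bd F k v \<in> chains N k j"
  define q where "q a = mon_quot u (v a)" for a
  have lq: "lookup (q a) m = lookup (v a) (u + m)" for a m
    by (simp add: q_def lookup_mon_quot)
  have q: "q \<in> chains UNIV i (j - int (mdeg u))"
    unfolding mem_chains_iff
  proof (intro allI ballI)
    fix a m assume "m \<in> keys (q a)"
    then have "u + m \<in> keys (v a)" by (simp add: lq in_keys_iff)
    then have "a \<in> gbasis F i \<and> int (mdeg (u + m)) + gdeg F i a = j"
      using v(1) unfolding mem_chains_iff by blast
    then show "a \<in> gbasis F i \<and> m \<in> UNIV \<and> int (mdeg m) + gdeg F i a = j - int (mdeg u)"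
      by (simp add: mdeg_add)
  qed
  have p: "(\<lambda>a. v a - monomial u * q a) \<in> chains N i j"
    unfolding mem_chains_iff
  proof (intro allI ballI)
    fix a m assume m: "m \<in> keys (v a - monomial u * q a)"
    then have "m \<in> keys (v a)" "\<not> (\<exists>c. m = u + c)"
      using mon_quot_remainder[of m "v a" u] by (auto simp: q_def)
    then show "a \<in> gbasis F i \<and> m \<in> N \<and> int (mdeg m) + gdeg F i a = j"
      using v(1) unfolding mem_chains_iff up_def by blast
  qed
  have "bd F k q \<in> chains {m. u + m \<in> N} k (j - int (mdeg u))" if k: "i = Suc k" for k
  proof -
    have "bd F k (\<lambda>a. v a - monomial u * q a) \<in> chains N k j"
      using p assms(2) k by (intro bd_chains) auto
    then have "(\<lambda>b. bd F k v b - bd F k (\<lambda>a. v a - monomial u * q a) b) \<in> chains N k j"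
      using v(2) k chains_diff by blast
    then have *: "(\<lambda>b. monomial u * bd F k q b) \<in> chains N k j"
      by (simp add: bd_diff bd_mult)
    show ?thesis
      unfolding mem_chains_iff
    proof (intro allI ballI)
      fix b m assume "m \<in> keys (bd F k q b)"
      then have "u + m \<in> keys (monomial u * bd F k q b)" by (simp add: keys_monomial_mult)
      then have "b \<in> gbasis F k \<and> u + m \<in> N \<and> int (mdeg (u + m)) + gdeg F k b = j"
        using * unfolding mem_chains_iff by blast
      then show "b \<in> gbasis F k \<and> m \<in> {m. u + m \<in> N} \<and> int (mdeg m) + gdeg F k b = j - int (mdeg u)"
        by (simp add: mdeg_add)
    qed
  qed
  then obtain w where w: "w \<in> chains UNIV (Suc i) (j - int (mdeg u))"
     "(\<lambda>a. q a - bd F i w a) \<in> chains {m. u + m \<in> N} i (j - int (mdeg u))"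
    using assms(1) q unfolding rel_acyclic_def by blast
  have mult: "(\<lambda>a. monomial u * z a) \<in> chains M' l j"
    if "z \<in> chains M l (j - int (mdeg u))" "\<And>m. m \<in> M \<Longrightarrow> u + m \<in> M'" for z M M' l
    unfolding mem_chains_iff keys_monomial_mult
  proof (intro allI ballI)
    fix a m assume "m \<in> (+) u ` keys (z a)"
    then obtain k where k: "k \<in> keys (z a)" "m = u + k" by blast
    then have "a \<in> gbasis F l \<and> k \<in> M \<and> int (mdeg k) + gdeg F l a = j - int (mdeg u)"
      using that(1) unfolding mem_chains_iff by blast
    then show "a \<in> gbasis F l \<and> m \<in> M' \<and> int (mdeg m) + gdeg F l a = j"
      using that(2) k(2) by (auto simp: mdeg_add)
  qed
  have "(\<lambda>a. monomial u * w a) \<in> chains (N \<union> up {u}) (Suc i) j"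
    using w(1) by (rule mult) (auto simp: up_def)
  moreover have "(\<lambda>a. (v a - monomial u * q a) + monomial u * (q a - bd F i w a)) \<in> chains N i j"
    using w(2) by (intro chains_add[OF p] mult) auto
  then have "(\<lambda>a. v a - bd F i (\<lambda>a. monomial u * w a) a) \<in> chains N i j"
    by (simp add: bd_mult right_diff_distrib)
  ultimately show "\<exists>w\<in>chains (N \<union> up {u}) (Suc i) j. (\<lambda>a. v a - bd F i w a) \<in> chains N i j"
    by blast
qed

text \<open>
  Exactness of \<open>F\<close> is an ungraded statement. As the differential is homogeneous, the component of the
  right degree of any preimage is again a preimage.
\<close>

lemma homogeneous_preimage:
  assumes v: "v \<in> chains UNIV i j" and w: "w \<in> free_module F (Suc i)" "v = bd F i w"
  shows "\<exists>w\<in>chains UNIV (Suc i) j. v = bd F i w"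
proof -
  define w' where "w' a = trunc (\<lambda>m. int (mdeg m) + gdeg F (Suc i) a = j) (w a)" for a
  have w': "w' \<in> chains UNIV (Suc i) j"
    unfolding mem_chains_iff w'_def keys_trunc using free_module_key[OF w(1)] by blast
  have "(\<lambda>b. v b - bd F i w' b) = (\<lambda>_. 0)"
  proof (rule ext, rule ccontr)
    fix b assume "v b - bd F i w' b \<noteq> 0"
    then obtain m where m: "m \<in> keys (v b - bd F i w' b)" by (metis keys_eq_empty ex_in_conv)
    have "(\<lambda>b. v b - bd F i w' b) \<in> chains UNIV i j"
      using v bd_chains[OF w'] by (intro chains_diff) (auto simp: up_closed_def)
    then have mj: "int (mdeg m) + gdeg F i b = j" using m unfolding mem_chains_iff by blast
    have "m \<in> keys (bd F i (\<lambda>a. w a - w' a) b)" using m by (simp add: bd_diff w(2))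
    then obtain a k l where *: "k \<in> keys (w a - w' a)" "m = k + l"
      "int (mdeg l) + gdeg F i b = gdeg F (Suc i) a" by (rule bd_key)
    then have "int (mdeg k) + gdeg F (Suc i) a \<noteq> j"
      by (auto simp: in_keys_iff lookup_minus w'_def lookup_trunc split: if_splits)
    then show False using * mj by (simp add: mdeg_add)
  qed
  then have "v = bd F i w'" by (simp add: fun_eq_iff)
  then show ?thesis using w' by blast
qed

text \<open>
  As \<open>F \<otimes> S = F\<close> resolves \<open>K\<close>, its only homology is \<open>K\<close> in homological degree 0. It sits in internal
  degree 0 because the augmentation vanishes on chains of every other degree.
\<close>

lemma rel_acyclic_whole_ring:
  assumes "i > 0 \<or> j \<noteq> 0"
  shows "rel_acyclic UNIV {} i j"
  unfolding rel_acyclic_def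
proof (intro ballI impI)
  fix v assume v: "v \<in> chains UNIV i j" "\<forall>k. i = Suc k \<longrightarrow> bd F k v \<in> chains {} k j"
  have "v \<in> bd F i ` free_module F (Suc i)"
  proof (cases i)
    case 0
    have "lookup (v a) 0 * gaug F a = 0" if "a \<in> gbasis F 0" for a
    proof (rule ccontr)
      assume "lookup (v a) 0 * gaug F a \<noteq> 0"
      then have "lookup (v a) 0 \<noteq> 0" "gaug F a \<noteq> 0" by auto
      then have "0 \<in> keys (v a)" "gdeg F 0 a = 0"
        using res_aug_degree that by (auto simp: in_keys_iff)
      then have "int (mdeg (0 :: 'n \<Rightarrow>\<^sub>0 nat)) + gdeg F 0 a = j" "gdeg F 0 a = 0"
        using v(1) 0 unfolding mem_chains_iff by blast+
      then have "j = 0" by (simp add: mdeg_def)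
      then show False using assms 0 by simp
    qed
    then have "augmentation F v = 0" by (simp add: augmentation_def)
    then have "v \<in> {v \<in> free_module F 0. augmentation F v = 0}"
      using chains_free[OF v(1)] 0 by simp
    also have "\<dots> = bd F 0 ` free_module F 1" by (rule res_exact_0)
    finally show ?thesis using 0 by simp
  next
    case (Suc k)
    have "bd F k v \<in> chains {} k j" using v(2) Suc by blast
    then have "bd F k v = (\<lambda>_. 0)" by (auto simp: mem_chains_iff)
    then have "v \<in> {v \<in> free_module F (Suc k). bd F k v = (\<lambda>_. 0)}"
      using chains_free[OF v(1)] Suc by simp
    also have "\<dots> = bd F (Suc k) ` free_module F (Suc (Suc k))" by (rule res_exact)
    finally show ?thesis using Suc by simp
  qed
  then obtain w where "w \<in> chains UNIV (Suc i) j" "v = bd F i w"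
    using homogeneous_preimage[OF v(1)] by blast
  then show "\<exists>w\<in>chains UNIV (Suc i) j. (\<lambda>a. v a - bd F i w a) \<in> chains {} i j"
    by (intro bexI[of _ w]) (auto simp: mem_chains_iff)
qed

text \<open>
  \<open>Tor\<^sub>i(K, S/(x\<^sub>c | c \<in> C))\<close> lives in degree \<open>i\<close> only. In the sequence
  \<open>0 \<rightarrow> S/(C)(-1) \<rightarrow> S/(C) \<rightarrow> S/(C, x\<^sub>c) \<rightarrow> 0\<close> both neighbours of \<open>Tor\<^sub>i(S/(C, x\<^sub>c))\<^sub>j\<close>, namely
  \<open>Tor\<^sub>i(S/(C))\<^sub>j\<close> and \<open>Tor\<^sub>i\<^sub>-\<^sub>1(S/(C))\<^sub>j\<^sub>-\<^sub>1\<close>, vanish for \<open>j \<noteq> i\<close>, so the maps between them do not matter.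
\<close>

lemma rel_acyclic_variables:
  assumes "finite C" "j \<noteq> int i"
  shows "rel_acyclic UNIV (up ((\<lambda>c. single c 1) ` C)) i j"
  using assms
proof (induction C arbitrary: i j rule: finite_induct)
  case empty
  then show ?case using rel_acyclic_whole_ring[of i j] by (cases i) (auto simp: up_def)
next
  case (insert c C)
  let ?L = "up ((\<lambda>c. single c 1) ` C) :: ('n \<Rightarrow>\<^sub>0 nat) set"
  have N: "up ((\<lambda>c. single c 1) ` insert c C) = ?L \<union> up {single c 1}"
    using up_Un[of "(\<lambda>c. single c 1) ` C" "{single c 1}"] by (simp add: insert_is_Un[symmetric])
  have colon: "{m. single c 1 + m \<in> ?L} = ?L"
    using insert.hyps(2)
    by (auto simp: mem_up_iff lookup_add lookup_single when_def split: if_splits)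
  show ?case
    unfolding N
  proof (rule rel_acyclic_quotient)
    show "rel_acyclic UNIV ?L i j" using insert by blast
    fix k assume "i = Suc k"
    then have "rel_acyclic UNIV ?L k (j - 1)" using insert by auto
    then show "rel_acyclic (?L \<union> up {single c 1}) ?L k j"
      by (intro rel_acyclic_shift up_closed_up) (simp add: colon mdeg_single del: One_nat_def)
  qed auto
qed

end

end

section \<open>The Koszul resolution\<close>

definition variable_ideal :: "'n set \<Rightarrow> ('n, 'a::comm_ring_1) mpoly set" where
  "variable_ideal C = mon_span (up ((\<lambda>c. single c 1) ` C))"

lemma mem_variable_ideal:
  "f \<in> variable_ideal C \<longleftrightarrow> (\<forall>m\<in>keys f. \<exists>c\<in>C. 0 < lookup m c)"
proof -
  have "m \<in> up ((\<lambda>c. single c 1) ` C) \<longleftrightarrow> (\<exists>c\<in>C. 0 < lookup m c)" for m :: "'a \<Rightarrow>\<^sub>0 nat"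
    by (auto simp: mem_up_iff lookup_single when_def Suc_le_eq)
  then show ?thesis by (auto simp: variable_ideal_def mon_span_def)
qed

lemma variable_ideal_mult: "f \<in> variable_ideal C \<Longrightarrow> r * f \<in> variable_ideal C"
  unfolding variable_ideal_def by (intro mon_span_mult up_closed_up)

text \<open>
  This is what keeps the iterated mapping cone exact: \<open>x\<^sub>c\<close> is a nonzerodivisor modulo the other
  variables.
\<close>

lemma variable_ideal_nonzerodivisor:
  assumes "monomial (single c 1) * f \<in> variable_ideal C" "c \<notin> C"
  shows "f \<in> variable_ideal C"
  unfolding mem_variable_ideal
proof
  fix m assume "m \<in> keys f"
  then have "single c 1 + m \<in> keys (monomial (single c 1) * f)" by (simp add: keys_monomial_mult)
  then obtain b where "b \<in> C" "0 < lookup (single c 1 + m) b"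
    using assms(1) unfolding mem_variable_ideal by blast
  then show "\<exists>c\<in>C. 0 < lookup m c"
    using assms(2) by (intro bexI[of _ b]) (auto simp: lookup_add lookup_single when_def split: if_splits)
qed

text \<open>
  A graded free resolution of \<open>S/(x\<^sub>c | c \<in> C)\<close> beginning with \<open>F\<^sub>0 = S\<close>. The augmentation values are
  the ones that make it a resolution of \<open>K\<close> once \<open>C\<close> contains all variables.
\<close>

definition resolves_variables ::
  "'n set \<Rightarrow> ('n::finite, 'a::comm_ring_1) graded_free_complex \<Rightarrow> bool" where
  "resolves_variables C F \<longleftrightarrow>
     (\<forall>i. finite (gbasis F i)) \<and>
     (\<forall>i. \<forall>a\<in>gbasis F (Suc i). \<forall>b\<in>gbasis F i. \<forall>m\<in>keys (gdiff F i a b).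
        int (mdeg m) + gdeg F i b = gdeg F (Suc i) a) \<and>
     gbasis F 0 = {0} \<and> gdeg F 0 0 = 0 \<and> gaug F 0 = 1 \<and>
     bd F 0 ` free_module F 1 = {v \<in> free_module F 0. v 0 \<in> variable_ideal C} \<and>
     (\<forall>i. {v \<in> free_module F (Suc i). bd F i v = (\<lambda>_. 0)} =
          bd F (Suc i) ` free_module F (Suc (Suc i)))"

text \<open>
  The mapping cone of multiplication by \<open>x\<^sub>c\<close> on \<open>F\<close>, that is \<open>F\<^sub>i \<oplus> F\<^sub>i\<^sub>-\<^sub>1(-1)\<close> in degree \<open>i\<close> with
  differential \<open>(p, q) \<mapsto> (dp + x\<^sub>c q, -dq)\<close>. Even basis indices belong to the first summand and odd ones to
  the second.
\<close>

definition cone :: "'n \<Rightarrow> ('n, 'a::comm_ring_1) graded_free_complex \<Rightarrow> ('n, 'a) graded_free_complex"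
  where
  "cone c F = \<lparr>
     gbasis = (\<lambda>i. (*) 2 ` gbasis F i \<union>
       (case i of 0 \<Rightarrow> {} | Suc k \<Rightarrow> (\<lambda>a. 2 * a + 1) ` gbasis F k)),
     gdeg = (\<lambda>i a. if even a then gdeg F i (a div 2) else gdeg F (i - 1) (a div 2) + 1),
     gdiff = (\<lambda>i a b.
       if even a then (if even b then gdiff F i (a div 2) (b div 2) else 0)
       else if even b then (if a div 2 = b div 2 then monomial (single c 1) else 0)
       else - gdiff F (i - 1) (a div 2) (b div 2)),
     gaug = (\<lambda>a. gaug F (a div 2)) \<rparr>"

definition evens :: "(nat \<Rightarrow> 'b) \<Rightarrow> nat \<Rightarrow> 'b" where "evens v a = v (2 * a)"
definition odds :: "(nat \<Rightarrow> 'b) \<Rightarrow> nat \<Rightarrow> 'b" where "odds v a = v (2 * a + 1)"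
definition interleave :: "(nat \<Rightarrow> 'b) \<Rightarrow> (nat \<Rightarrow> 'b) \<Rightarrow> nat \<Rightarrow> 'b" where
  "interleave p q a = (if even a then p (a div 2) else q (a div 2))"

lemma evens_interleave [simp]: "evens (interleave p q) = p"
  by (auto simp: evens_def interleave_def)

lemma odds_interleave [simp]: "odds (interleave p q) = q"
  by (auto simp: odds_def interleave_def)

lemma even_odd_eqI: "evens v = evens w \<Longrightarrow> odds v = odds w \<Longrightarrow> v = w"
  by (rule ext) (metis evens_def odds_def even_two_times_div_two odd_two_times_div_two_succ)

lemma even_odd_eq_iff: "v = w \<longleftrightarrow> evens v = evens w \<and> odds v = odds w"
  using even_odd_eqI by metis

lemma mem_gbasis_cone:
  "2 * a \<in> gbasis (cone c F) i \<longleftrightarrow> a \<in> gbasis F i"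
  "Suc (2 * a) \<in> gbasis (cone c F) 0 \<longleftrightarrow> False"
  "Suc (2 * a) \<in> gbasis (cone c F) (Suc i) \<longleftrightarrow> a \<in> gbasis F i"
proof -
  have *: "2 * a \<noteq> Suc (2 * b)" "Suc (2 * b) \<noteq> 2 * a" for a b :: nat by presburger+
  show "2 * a \<in> gbasis (cone c F) i \<longleftrightarrow> a \<in> gbasis F i"
    "Suc (2 * a) \<in> gbasis (cone c F) 0 \<longleftrightarrow> False"
    "Suc (2 * a) \<in> gbasis (cone c F) (Suc i) \<longleftrightarrow> a \<in> gbasis F i"
    using * by (auto simp: cone_def image_iff split: nat.splits)
qed

lemma ball_even_odd:
  "(\<forall>a::nat. P a) \<longleftrightarrow> (\<forall>a. P (2 * a)) \<and> (\<forall>a. P (Suc (2 * a)))"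
  by (metis even_two_times_div_two odd_two_times_div_two_succ Suc_eq_plus1)

lemma free_module_cone_0:
  "v \<in> free_module (cone c F) 0 \<longleftrightarrow> evens v \<in> free_module F 0 \<and> odds v = (\<lambda>_. 0)"
  by (subst free_module_def, subst mem_Collect_eq, subst ball_even_odd)
     (auto simp: free_module_def mem_gbasis_cone evens_def odds_def fun_eq_iff)

lemma free_module_cone_Suc:
  "v \<in> free_module (cone c F) (Suc i) \<longleftrightarrow>
     evens v \<in> free_module F (Suc i) \<and> odds v \<in> free_module F i"
  by (subst free_module_def, subst mem_Collect_eq, subst ball_even_odd)
     (auto simp: free_module_def mem_gbasis_cone evens_def odds_def)

lemma sum_gbasis_cone:
  assumes "\<And>i. finite (gbasis F i)"
  shows "sum f (gbasis (cone c F) (Suc i)) =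
    (\<Sum>a\<in>gbasis F (Suc i). f (2 * a)) + (\<Sum>a\<in>gbasis F i. f (Suc (2 * a)))"
proof -
  have "sum f (gbasis (cone c F) (Suc i)) =
      sum f ((*) 2 ` gbasis F (Suc i)) + sum f ((\<lambda>a. 2 * a + 1) ` gbasis F i)"
    unfolding cone_def using assms
    by (simp, subst sum.union_disjoint) (auto, presburger)
  then show ?thesis by (simp add: sum.reindex inj_on_def)
qed

lemma evens_bd_cone:
  assumes "\<And>i. finite (gbasis F i)" "odds v \<in> free_module F i"
  shows "evens (bd (cone c F) i v) =
    (\<lambda>b. bd F i (evens v) b + monomial (single c 1) * odds v b)"
proof
  fix b
  show "evens (bd (cone c F) i v) b = bd F i (evens v) b + monomial (single c 1) * odds v b"
  proof (cases "b \<in> gbasis F i")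
    case True
    have d: "gdiff (cone c F) i (2 * a) (2 * b) = gdiff F i a b"
      "gdiff (cone c F) i (Suc (2 * a)) (2 * b) = (if a = b then monomial (single c 1) else 0)" for a
      by (simp_all add: cone_def)
    have "(\<Sum>a\<in>gbasis F i. v (Suc (2 * a)) * (if a = b then monomial (single c 1) else 0)) =
        (\<Sum>a\<in>gbasis F i. if a = b then monomial (single c 1) * v (Suc (2 * a)) else 0)"
      by (intro sum.cong) (auto simp: mult.commute)
    also have "\<dots> = monomial (single c 1) * v (Suc (2 * b))" using True assms(1) by simp
    finally show ?thesis
      using True assms(1)
      by (simp add: bd_def mem_gbasis_cone sum_gbasis_cone d
          evens_def odds_def)
  next
    case False
    then show ?thesis
      using assms(2)
      by (simp add: evens_def bd_def mem_gbasis_cone free_module_def)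
  qed
qed

lemma odds_bd_cone_0: "odds (bd (cone c F) 0 v) = (\<lambda>_. 0)"
  by (auto simp: odds_def bd_def mem_gbasis_cone)

lemma odds_bd_cone_Suc:
  assumes "\<And>i. finite (gbasis F i)"
  shows "odds (bd (cone c F) (Suc k) v) = (\<lambda>b. - bd F k (odds v) b)"
proof
  fix b
  have "gdiff (cone c F) (Suc k) (2 * a) (Suc (2 * b)) = 0"
    "gdiff (cone c F) (Suc k) (Suc (2 * a)) (Suc (2 * b)) = - gdiff F k a b" for a
    by (simp_all add: cone_def)
  then show "odds (bd (cone c F) (Suc k) v) b = - bd F k (odds v) b"
    using assms
    by (simp add: odds_def bd_def mem_gbasis_cone sum_gbasis_cone sum_negf)
qed

lemma free_module_0: "(\<lambda>_. 0) \<in> free_module F i"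
  by (simp add: free_module_def)

lemma free_module_add:
  "v \<in> free_module F i \<Longrightarrow> w \<in> free_module F i \<Longrightarrow> (\<lambda>a. v a + w a) \<in> free_module F i"
  by (simp add: free_module_def)

lemma free_module_mult: "v \<in> free_module F i \<Longrightarrow> (\<lambda>a. r * v a) \<in> free_module F i"
  by (simp add: free_module_def)

lemma bd_neg: "bd F i (\<lambda>a. - v a) = (\<lambda>b. - bd F i v b)"
  using bd_mult[of F i "-1" v] by simp

lemma free_module_neg: "v \<in> free_module F i \<Longrightarrow> (\<lambda>a. - v a) \<in> free_module F i"
  by (simp add: free_module_def)

context
  fixes F :: "('n::finite, 'a::comm_ring_1) graded_free_complex" and C c
  assumes F: "resolves_variables C F" and c: "c \<notin> C"
begin

abbreviation "xc \<equiv> (monomial (single c 1) :: ('n, 'a) mpoly)"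

lemma cone_base_finite: "finite (gbasis F i)" and cone_base_gbasis_0: "gbasis F 0 = {0}"
  and cone_base_image_0: "bd F 0 ` free_module F 1 = {v \<in> free_module F 0. v 0 \<in> variable_ideal C}"
  and cone_base_exact: "{v \<in> free_module F (Suc i). bd F i v = (\<lambda>_. 0)} =
          bd F (Suc i) ` free_module F (Suc (Suc i))"
  using F unfolding resolves_variables_def by simp_all

text \<open>
  If \<open>dp + x\<^sub>c q = 0\<close> and \<open>dq = 0\<close>, then \<open>q = dw\<close>, by exactness of \<open>F\<close> or, at the bottom, because \<open>x\<^sub>c\<close>
  is a nonzerodivisor on \<open>S/(C)\<close>. Then \<open>p + x\<^sub>c w\<close> is a cycle, hence some \<open>du\<close>, and \<open>(p, q)\<close> is the
  image of \<open>(u, -w)\<close>.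
\<close>

lemma cone_exact:
  "{v \<in> free_module (cone c F) (Suc i). bd (cone c F) i v = (\<lambda>_. 0)} =
   bd (cone c F) (Suc i) ` free_module (cone c F) (Suc (Suc i))"
proof (intro equalityI subsetI)
  fix v assume "v \<in> {v \<in> free_module (cone c F) (Suc i). bd (cone c F) i v = (\<lambda>_. 0)}"
  then have v: "evens v \<in> free_module F (Suc i)" "odds v \<in> free_module F i"
    and z: "bd (cone c F) i v = (\<lambda>_. 0)" by (auto simp: free_module_cone_Suc)
  have "evens (bd (cone c F) i v) = (\<lambda>_. 0)" "odds (bd (cone c F) i v) = (\<lambda>_. 0)"
    unfolding z by (auto simp: evens_def odds_def)
  then have pq: "bd F i (evens v) b + xc * odds v b = 0"
    and q: "\<And>k. i = Suc k \<Longrightarrow> bd F k (odds v) b = 0" for b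
    using evens_bd_cone[of F, OF cone_base_finite v(2), of c] odds_bd_cone_Suc[of F, OF cone_base_finite, of c]
    by (auto simp: fun_eq_iff)
  have "odds v \<in> bd F i ` free_module F (Suc i)"
  proof (cases i)
    case 0
    have "xc * odds v 0 = - bd F 0 (evens v) 0"
      using pq[of 0] 0 by (simp add: add_eq_0_iff)
    moreover have "bd F 0 (evens v) 0 \<in> variable_ideal C"
      using cone_base_image_0 v(1) 0 by (auto simp: set_eq_iff image_iff)
    then have "- 1 * bd F 0 (evens v) 0 \<in> variable_ideal C" by (rule variable_ideal_mult)
    ultimately have "xc * odds v 0 \<in> variable_ideal C" by simp
    then have "odds v 0 \<in> variable_ideal C" using c by (rule variable_ideal_nonzerodivisor)
    then show ?thesis using cone_base_image_0 v(2) 0 by simp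
  next
    case (Suc k)
    then show ?thesis using cone_base_exact[of k] q v(2) by (auto simp: fun_eq_iff)
  qed
  then obtain w where w: "w \<in> free_module F (Suc i)" "odds v = bd F i w" by blast
  define e where "e a = evens v a + xc * w a" for a
  have "e \<in> free_module F (Suc i)"
    unfolding e_def using free_module_add free_module_mult v(1) w(1) by blast
  moreover have "bd F i e = (\<lambda>_. 0)"
    using pq unfolding e_def by (simp add: bd_add bd_mult w(2))
  ultimately obtain u where u: "u \<in> free_module F (Suc (Suc i))" "e = bd F (Suc i) u"
    using cone_base_exact[of i] by blast
  let ?w = "interleave u (\<lambda>a. - w a)"
  have "evens v = evens (bd (cone c F) (Suc i) ?w)"
  proof
    fix b
    have "bd F (Suc i) u b = evens v b + xc * w b" using e_def[of b] u(2) by simp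
    then show "evens v b = evens (bd (cone c F) (Suc i) ?w) b"
      using free_module_neg[OF w(1)] by (subst evens_bd_cone[of F, OF cone_base_finite]) simp_all
  qed
  moreover have "odds v = odds (bd (cone c F) (Suc i) ?w)"
    unfolding odds_bd_cone_Suc[of F, OF cone_base_finite] odds_interleave bd_neg w(2) by simp
  ultimately have "v = bd (cone c F) (Suc i) ?w" by (rule even_odd_eqI)
  moreover have "?w \<in> free_module (cone c F) (Suc (Suc i))"
    using u(1) free_module_neg[OF w(1)] by (simp add: free_module_cone_Suc)
  ultimately show "v \<in> bd (cone c F) (Suc i) ` free_module (cone c F) (Suc (Suc i))" by blast
next
  fix v assume "v \<in> bd (cone c F) (Suc i) ` free_module (cone c F) (Suc (Suc i))"
  then obtain w where w: "evens w \<in> free_module F (Suc (Suc i))" "odds w \<in> free_module F (Suc i)"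
    and v: "v = bd (cone c F) (Suc i) w" by (auto simp: free_module_cone_Suc)
  have p: "evens v = (\<lambda>b. bd F (Suc i) (evens w) b + xc * odds w b)"
    unfolding v by (rule evens_bd_cone[of F, OF cone_base_finite w(2)])
  have q: "odds v = (\<lambda>b. - bd F i (odds w) b)"
    unfolding v by (rule odds_bd_cone_Suc[of F, OF cone_base_finite])
  have dd: "bd F k (bd F (Suc k) y) = (\<lambda>_. 0)" if "y \<in> free_module F (Suc (Suc k))" for y k
    using cone_base_exact[of k] that by blast
  have fp: "evens v \<in> free_module F (Suc i)"
    unfolding p using free_module_add free_module_mult bd_free w(2) by blast
  have fq: "odds v \<in> free_module F i"
    unfolding q using free_module_neg bd_free by blast
  have "evens (bd (cone c F) i v) = (\<lambda>_. 0)"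
    using evens_bd_cone[of F, OF cone_base_finite fq, of c] unfolding p q
    by (simp add: bd_add bd_mult dd[OF w(1)])
  moreover have "odds (bd (cone c F) i v) = (\<lambda>_. 0)"
  proof (cases i)
    case 0 then show ?thesis by (simp add: odds_bd_cone_0)
  next
    case (Suc k)
    then show ?thesis
      using odds_bd_cone_Suc[of F, OF cone_base_finite, of c k v] dd[of "odds w" k] w(2) by (simp add: q bd_neg)
  qed
  ultimately have "bd (cone c F) i v = (\<lambda>_. 0)"
    unfolding even_odd_eq_iff[of "bd (cone c F) i v"] by (simp add: evens_def odds_def fun_eq_iff)
  then show "v \<in> {v \<in> free_module (cone c F) (Suc i). bd (cone c F) i v = (\<lambda>_. 0)}"
    using fp fq by (simp add: free_module_cone_Suc)
qed

lemma cone_image_0: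
  "bd (cone c F) 0 ` free_module (cone c F) 1 =
   {v \<in> free_module (cone c F) 0. v 0 \<in> variable_ideal (insert c C)}"
proof (intro equalityI subsetI)
  fix v assume "v \<in> bd (cone c F) 0 ` free_module (cone c F) 1"
  then obtain w where w: "evens w \<in> free_module F (Suc 0)" "odds w \<in> free_module F 0"
    and v: "v = bd (cone c F) 0 w" by (auto simp: free_module_cone_Suc)
  have "v 0 = evens v 0" by (simp add: evens_def)
  also have "\<dots> = bd F 0 (evens w) 0 + xc * odds w 0"
    unfolding v by (simp add: evens_bd_cone[of F, OF cone_base_finite w(2)])
  finally have v0: "v 0 = bd F 0 (evens w) 0 + xc * odds w 0" .
  have "bd F 0 (evens w) 0 \<in> variable_ideal C"
    using cone_base_image_0 w(1) by (auto simp: set_eq_iff image_iff)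
  then have "bd F 0 (evens w) 0 \<in> variable_ideal (insert c C)"
    unfolding mem_variable_ideal by blast
  moreover have "xc * odds w 0 \<in> variable_ideal (insert c C)"
    unfolding mem_variable_ideal keys_monomial_mult by (auto simp: lookup_add)
  ultimately have "v 0 \<in> variable_ideal (insert c C)"
    unfolding v0 variable_ideal_def by (rule mon_span_add)
  then show "v \<in> {v \<in> free_module (cone c F) 0. v 0 \<in> variable_ideal (insert c C)}"
    using bd_free[of "cone c F" 0 w] v by simp
next
  fix v assume "v \<in> {v \<in> free_module (cone c F) 0. v 0 \<in> variable_ideal (insert c C)}"
  then have v: "evens v \<in> free_module F 0" "odds v = (\<lambda>_. 0)" "v 0 \<in> variable_ideal (insert c C)"
    by (auto simp: free_module_cone_0)
  define r where "r = v 0 - xc * mon_quot (single c 1) (v 0)"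
  have "r \<in> variable_ideal C"
    unfolding mem_variable_ideal
  proof
    fix m assume "m \<in> keys r"
    then have m: "m \<in> keys (v 0)" "\<not> (\<exists>k. m = single c 1 + k)"
      using mon_quot_remainder[of m "v 0" "single c 1"] by (simp_all add: r_def)
    obtain b where b: "b \<in> insert c C" "0 < lookup m b"
      using v(3) m(1) unfolding mem_variable_ideal by blast
    have "\<not> 0 < lookup m c"
    proof
      assume "0 < lookup m c"
      then have "\<forall>i. lookup (single c 1) i \<le> lookup m i"
        by (simp add: lookup_single when_def Suc_le_eq)
      then show False using m(2) mon_le_iff_add by blast
    qed
    then have "b \<in> C" using b by auto
    then show "\<exists>b\<in>C. 0 < lookup m b" using b(2) by (rule bexI[rotated])
  qed
  then have "(\<lambda>a. if a = 0 then r else 0) \<in> {v \<in> free_module F 0. v 0 \<in> variable_ideal C}"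
    by (simp add: free_module_def cone_base_gbasis_0)
  then obtain p where p: "p \<in> free_module F 1" "bd F 0 p = (\<lambda>a. if a = 0 then r else 0)"
    unfolding cone_base_image_0[symmetric] by auto
  let ?q = "\<lambda>a. if a = 0 then mon_quot (single c 1) (v 0) else 0"
  have q: "?q \<in> free_module F 0" by (simp add: free_module_def cone_base_gbasis_0)
  have "evens v a = (if a = 0 then v 0 else 0)" for a
    using v(1) by (auto simp: free_module_def cone_base_gbasis_0 evens_def)
  then have "evens v = evens (bd (cone c F) 0 (interleave p ?q))"
    using q by (auto simp: evens_bd_cone[of F, OF cone_base_finite] p(2) r_def)
  moreover have "odds v = odds (bd (cone c F) 0 (interleave p ?q))"
    unfolding v(2) odds_bd_cone_0 ..
  ultimately have "v = bd (cone c F) 0 (interleave p ?q)" by (rule even_odd_eqI)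
  moreover have "interleave p ?q \<in> free_module (cone c F) 1"
    using p(1) q by (simp add: free_module_cone_Suc)
  ultimately show "v \<in> bd (cone c F) 0 ` free_module (cone c F) 1" by blast
qed

lemma cone_degree:
  assumes a: "a \<in> gbasis (cone c F) (Suc i)" and b: "b \<in> gbasis (cone c F) i"
    and m: "m \<in> keys (gdiff (cone c F) i a b)"
  shows "int (mdeg m) + gdeg (cone c F) i b = gdeg (cone c F) (Suc i) a"
proof -
  have deg: "int (mdeg m) + gdeg F i b = gdeg F (Suc i) a"
    if "a \<in> gbasis F (Suc i)" "b \<in> gbasis F i" "m \<in> keys (gdiff F i a b)" for i a b m
    using F that by (simp add: resolves_variables_def)
  have g: "gdeg (cone c F) i (2 * a) = gdeg F i a"
    "gdeg (cone c F) i (Suc (2 * a)) = gdeg F (i - 1) a + 1" for i a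
    by (simp_all add: cone_def)
  have d: "gdiff (cone c F) i (2 * a) (2 * b) = gdiff F i a b"
    "gdiff (cone c F) i (2 * a) (Suc (2 * b)) = 0"
    "gdiff (cone c F) i (Suc (2 * a)) (2 * b) = (if a = b then xc else 0)"
    "gdiff (cone c F) i (Suc (2 * a)) (Suc (2 * b)) = - gdiff F (i - 1) a b" for i a b
    by (simp_all add: cone_def)
  have "\<exists>k. n = 2 * k \<or> n = Suc (2 * k)" for n :: nat by presburger
  then obtain a' b' where parity: "a = 2 * a' \<or> a = Suc (2 * a')" "b = 2 * b' \<or> b = Suc (2 * b')"
    by metis
  consider (ee) "a = 2 * a'" "b = 2 * b'" | (eo) "a = 2 * a'" "b = Suc (2 * b')"
    | (oe) "a = Suc (2 * a')" "b = 2 * b'" | (oo) "a = Suc (2 * a')" "b = Suc (2 * b')"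
    using parity by blast
  then show ?thesis
  proof cases
    case ee
    then show ?thesis using a b m deg[of a' i b' m] by (simp add: g d mem_gbasis_cone)
  next
    case eo
    then show ?thesis using m by (simp add: d)
  next
    case oe
    then have "a' = b'" "m = single c 1" using m by (auto simp: d split: if_splits)
    then show ?thesis using oe by (simp add: g mdeg_single)
  next
    case oo
    then obtain k where k: "i = Suc k" using b by (cases i) (auto simp: mem_gbasis_cone)
    then show ?thesis
      using a b m oo deg[of a' k b' m] by (simp add: g d mem_gbasis_cone in_keys_iff)
  qed
qed

lemma resolves_variables_cone: "resolves_variables (insert c C) (cone c F)"
proof -
  have "finite (gbasis (cone c F) i)" for i
    using cone_base_finite by (auto simp: cone_def split: nat.split)
  moreover have "gbasis (cone c F) 0 = {0}" "gdeg (cone c F) 0 0 = 0" "gaug (cone c F) 0 = 1"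
    using F by (auto simp: cone_def resolves_variables_def)
  ultimately show ?thesis
    unfolding resolves_variables_def using cone_degree cone_image_0 cone_exact by blast
qed

end

lemma resolves_no_variables:
  "resolves_variables {} (\<lparr> gbasis = (\<lambda>i. if i = 0 then {0} else {}), gdeg = (\<lambda>_ _. 0),
     gdiff = (\<lambda>_ _ _. 0), gaug = (\<lambda>_. 1) \<rparr> :: ('n::finite, 'a::comm_ring_1) graded_free_complex)"
proof -
  have "v \<in> variable_ideal {} \<longleftrightarrow> v = 0" for v :: "('n, 'a) mpoly"
    unfolding mem_variable_ideal using keys_eq_empty[of v] by auto
  then show ?thesis
    unfolding resolves_variables_def
    by (auto simp: free_module_def bd_def fun_eq_iff image_def)
qed

lemma ex_resolves_variables:
  "\<exists>F :: ('n::finite, 'a::comm_ring_1) graded_free_complex. resolves_variables C F"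
  using finite[of C]
proof (induction C rule: finite_induct)
  case empty
  show ?case using resolves_no_variables by blast
next
  case (insert c C)
  then show ?case using resolves_variables_cone by blast
qed

text \<open>
  The chosen complex is a resolution because the iterated cone over all variables is one.
\<close>

theorem residue_field_resolution_is_resolution:
  "graded_free_resolution (residue_field_resolution :: ('n::finite, 'a::comm_ring_1) graded_free_complex)"
proof -
  obtain F :: "('n, 'a) graded_free_complex" where F: "resolves_variables UNIV F"
    using ex_resolves_variables by blast
  then have gb: "gbasis F 0 = {0}" and aug: "gaug F 0 = 1"
    unfolding resolves_variables_def by simp_all
  then have a: "augmentation F v = lookup (v 0) 0" for v by (simp add: augmentation_def)
  have "f \<in> variable_ideal UNIV \<longleftrightarrow> lookup f 0 = 0" for f :: "('n, 'a) mpoly"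
  proof -
    have "(\<exists>c. 0 < lookup m c) \<longleftrightarrow> m \<noteq> 0" for m :: "'n \<Rightarrow>\<^sub>0 nat"
      by (metis gr_zeroI lookup_zero not_less_zero poly_mapping_eqI)
    then show ?thesis unfolding mem_variable_ideal by (auto simp: in_keys_iff)
  qed
  then have im: "{v \<in> free_module F 0. augmentation F v = 0} = bd F 0 ` free_module F 1"
    using F by (simp add: a resolves_variables_def)
  have "k \<in> augmentation F ` free_module F 0" for k
    by (rule image_eqI[of _ _ "\<lambda>a. if a = 0 then single 0 k else 0"])
       (auto simp: a free_module_def gb)
  then have "graded_free_resolution F"
    using F im unfolding graded_free_resolution_def resolves_variables_def by auto
  then show ?thesis unfolding residue_field_resolution_def by (rule someI)
qed

section \<open>Linear quotients and regularity\<close>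

text \<open>
  If \<open>i < j\<close>, the exchange of \<open>x\<^sub>j\<close> for \<open>x\<^sub>i\<close> makes \<open>u\<close> lexicographically larger. So for every \<open>v\<close> larger
  than \<open>u\<close> there is an element \<open>w\<close> of \<open>A\<close>, also larger than \<open>u\<close>, such that \<open>w : u\<close> is a variable
  dividing \<open>v : u\<close>.
\<close>

definition lex_linear_quotients :: "('n::linorder \<Rightarrow>\<^sub>0 nat) set \<Rightarrow> bool" where
  "lex_linear_quotients A \<longleftrightarrow>
     (\<forall>u\<in>A. \<forall>v\<in>A. u < v \<longrightarrow> (\<exists>i j. i < j \<and> lookup u i < lookup v i \<and> 0 < lookup u j \<and>
        u - single j 1 + single i 1 \<in> A))"

lemma lex_less_iff:
  fixes u v :: "'n::linorder \<Rightarrow>\<^sub>0 nat"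
  shows "u < v \<longleftrightarrow> (\<exists>k. lookup u k < lookup v k \<and> (\<forall>l<k. lookup u l = lookup v l))"
  by (simp add: less_poly_mapping.rep_eq less_fun_def)

lemma lookup_exchange:
  "lookup (u - single j 1 + single i 1) k =
     lookup u k - (if k = j then 1 else 0) + (if k = i then 1 else (0::nat))"
  by (simp add: lookup_add lookup_minus lookup_single when_def)

lemma lex_less_exchange:
  fixes u :: "'n::linorder \<Rightarrow>\<^sub>0 nat"
  assumes "i < j"
  shows "u < u - single j 1 + single i 1"
  unfolding lex_less_iff using assms by (intro exI[of _ i]) (auto simp: lookup_exchange simp del: One_nat_def)

lemma mdeg_exchange:
  assumes "0 < lookup u j"
  shows "mdeg (u - single j 1 + single i 1) = mdeg u"
proof -
  have "u = (u - single j 1) + single j 1"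
    using assms by (intro poly_mapping_eqI) (auto simp: lookup_add lookup_minus lookup_single when_def)
  then have "mdeg u = mdeg (u - single j 1) + 1" by (metis mdeg_add mdeg_single)
  then show ?thesis by (simp add: mdeg_add mdeg_single)
qed

text \<open>
  Induction over the sets \<open>B\<close> of lexicographically largest elements of \<open>A\<close>. Adding the next element \<open>b\<close>
  adds the subquotient \<open>(B, b)/(B)\<close>, a shifted copy of \<open>S/((B) : b)\<close>, and this colon ideal is
  generated by variables.
\<close>

lemma rel_acyclic_linear_quotients:
  fixes F :: "('n::{finite,linorder}, 'a::comm_ring_1) graded_free_complex"
  assumes F: "graded_free_resolution F"
    and A: "finite A" "lex_linear_quotients A" "\<And>u. u \<in> A \<Longrightarrow> mdeg u = d"
    and j: "j \<noteq> int i + int d"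
  shows "rel_acyclic F (up A) {} i j"
proof -
  have "rel_acyclic F (up B) {} i j"
    if "finite B" "B \<subseteq> A" "\<And>u v. u \<in> B \<Longrightarrow> v \<in> A \<Longrightarrow> u < v \<Longrightarrow> v \<in> B" for B
    using that
  proof (induction B rule: finite_linorder_min_induct)
    case empty
    then show ?case by (auto simp: up_def rel_acyclic_def mem_chains_iff bd_zero
          intro!: bexI[of _ "\<lambda>_. 0"])
  next
    case (insert b B)
    \<comment> \<open>the variables \<open>w : b\<close>, where \<open>w\<close> arises from \<open>b\<close> by an exchange within \<open>A\<close>\<close>
    let ?C = "{i. \<exists>j. i < j \<and> 0 < lookup b j \<and> b - single j 1 + single i 1 \<in> A}"
    have b: "b \<in> A" using insert.prems(1) by blast
    have later: "v \<in> B" if "v \<in> A" "b < v" for v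
      using insert.prems(2)[of b v] that by auto
    have "\<And>u v. u \<in> B \<Longrightarrow> v \<in> A \<Longrightarrow> u < v \<Longrightarrow> v \<in> B"
      using insert.prems(2) insert.hyps(2) by fastforce
    then have acyclic_B: "rel_acyclic F (up B) {} i j"
      using insert.IH insert.prems(1) by blast
    have colon: "{m. b + m \<in> up B} = up ((\<lambda>c. single c 1) ` ?C)"
    proof (intro equalityI subsetI)
      fix m assume "m \<in> {m. b + m \<in> up B}"
      then obtain v where v: "v \<in> B" "\<And>i. lookup v i \<le> lookup b i + lookup m i"
        by (auto simp: mem_up_iff lookup_add)
      then have "b < v" "v \<in> A" using insert.hyps(2) insert.prems(1) by auto
      then obtain i j where ij: "i < j" "lookup b i < lookup v i" "0 < lookup b j"
         "b - single j 1 + single i 1 \<in> A"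
        using A(2) b unfolding lex_linear_quotients_def by blast
      then have "0 < lookup m i" using v(2)[of i] by simp
      then have "\<forall>k. lookup (single i 1) k \<le> lookup m k"
        by (simp add: lookup_single when_def Suc_le_eq)
      moreover have "i \<in> ?C" using ij by blast
      ultimately show "m \<in> up ((\<lambda>c. single c 1) ` ?C)" unfolding mem_up_iff by blast
    next
      fix m assume "m \<in> up ((\<lambda>c. single c 1) ` ?C)"
      then obtain i where i: "i \<in> ?C" "\<And>k. lookup (single i 1) k \<le> lookup m k"
        unfolding mem_up_iff by blast
      then obtain j where ij: "i < j" "b - single j 1 + single i 1 \<in> A" by blast
      then have "b - single j 1 + single i 1 \<in> B" using later lex_less_exchange by blast
      moreover have "lookup (b - single j 1 + single i 1) k \<le> lookup (b + m) k" for k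
        using i(2)[of k] by (auto simp: lookup_exchange lookup_add lookup_minus lookup_single when_def simp del: One_nat_def)
      ultimately show "m \<in> {m. b + m \<in> up B}" unfolding mem_up_iff by blast
    qed
    have "rel_acyclic F UNIV (up ((\<lambda>c. single c 1) ` ?C)) i (j - int (mdeg b))"
      using j A(3)[OF b] by (intro rel_acyclic_variables F) simp_all
    then have "rel_acyclic F (up B \<union> up {b}) (up B) i j"
      by (intro rel_acyclic_shift F up_closed_up) (simp only: colon)
    then have "rel_acyclic F (up B \<union> up {b}) {} i j"
      by (intro rel_acyclic_trans[OF F acyclic_B]) auto
    then show ?case using up_Un[of B "{b}"] by simp
  qed
  then show ?thesis using A(1) by blast
qed

lemma not_Tor_nonzeroI:
  fixes M :: "('n::finite \<Rightarrow>\<^sub>0 nat) set"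
  assumes "rel_acyclic (residue_field_resolution :: ('n, 'a::comm_ring_1) graded_free_complex) M {} i j"
  shows "\<not> Tor_nonzero i (mon_span M :: ('n, 'a) mpoly set) j"
proof -
  let ?F = "residue_field_resolution :: ('n, 'a) graded_free_complex"
  let ?I = "mon_span M :: ('n, 'a) mpoly set"
  let ?B = "tensor_boundaries ?F ?I i j"
  have B: "?B = bd ?F i ` chains ?F M (Suc i) j"
    by (simp add: tensor_boundaries_def chains_def)
  have coset: "(\<lambda>b a. z a + b a) ` ?B = ?B" if z: "z \<in> tensor_cycles ?F ?I i j" for z
  proof -
    have "z \<in> chains ?F M i j" "\<forall>k. i = Suc k \<longrightarrow> bd ?F k z \<in> chains ?F {} k j"
      using z by (cases i; simp add: chains_def tensor_chains_def free_module_0)+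
    then obtain w where w: "w \<in> chains ?F M (Suc i) j" "(\<lambda>a. z a - bd ?F i w a) \<in> chains ?F {} i j"
      using assms unfolding rel_acyclic_def by blast
    then have "z a - bd ?F i w a = 0" for a
      by (metis (no_types, lifting) empty_iff equals0I keys_eq_empty mem_chains_iff)
    then have zw: "z = bd ?F i w" by (simp add: fun_eq_iff)
    show ?thesis
    proof (intro equalityI subsetI)
      fix y assume "y \<in> (\<lambda>b a. z a + b a) ` ?B"
      then obtain w' where "w' \<in> chains ?F M (Suc i) j" "y = (\<lambda>a. z a + bd ?F i w' a)"
        unfolding B by blast
      then show "y \<in> ?B"
        unfolding B using chains_add[OF w(1)] by (intro image_eqI[of _ _ "\<lambda>a. w a + w' a"]) (simp_all add: zw bd_add)
    next
      fix y assume "y \<in> ?B"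
      then obtain w' where w': "w' \<in> chains ?F M (Suc i) j" "y = bd ?F i w'"
        unfolding B by blast
      then have "bd ?F i (\<lambda>a. w' a - w a) \<in> ?B"
        unfolding B using chains_diff[OF w'(1) w(1)] by blast
      then show "y \<in> (\<lambda>b a. z a + b a) ` ?B"
        by (rule rev_image_eqI) (simp add: bd_diff w'(2) zw)
    qed
  qed
  have "(\<lambda>_. 0) \<in> tensor_cycles ?F ?I i j"
    by (cases i) (simp_all add: tensor_chains_def free_module_0 bd_zero)
  then show ?thesis
    by (auto simp: Tor_nonzero_def Tor_def Let_def coset)
qed

text \<open>
  If \<open>f\<close> has no terms of degree below that of \<open>u\<close>, only the constant term of \<open>g\<close> contributes to the
  coefficient of \<open>f g\<close> at \<open>u\<close>.
\<close>

lemma lookup_mult_initial_degree: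
  fixes f g :: "('n::finite, 'a::comm_ring_1) mpoly"
  assumes "\<And>m. m \<in> keys f \<Longrightarrow> mdeg u \<le> mdeg m"
  shows "lookup (f * g) u = lookup f u * lookup g 0"
proof -
  have "lookup (f * g) u = (\<Sum>k\<in>keys f. lookup (single k (lookup f k) * g) u)"
    by (subst poly_sum_monomials[of f], simp only: sum_distrib_right lookup_sum)
  also have "\<dots> = (\<Sum>k\<in>keys f. if k = u then lookup f u * lookup g 0 else 0)"
  proof (intro sum.cong refl)
    fix k assume k: "k \<in> keys f"
    have "k = u" if "u = k + c" for c
    proof -
      have "mdeg c = 0" using assms[OF k] that by (simp add: mdeg_add)
      then show ?thesis using that by (simp add: mdeg_eq_0_iff)
    qed
    then show "lookup (single k (lookup f k) * g) u = (if k = u then lookup f u * lookup g 0 else 0)"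
      by (auto simp: lookup_single_mult intro: exI[of _ 0])
  qed
  also have "\<dots> = lookup f u * lookup g 0" by (auto simp: in_keys_iff)
  finally show ?thesis .
qed

text \<open>
  This is \<open>I/(x\<^sub>1, \<dots>, x\<^sub>n)I\<close> in its lowest degree. The resolution need not be minimal, so the class of
  \<open>x\<^sup>u\<close> is placed at a basis element \<open>a\<close> with \<open>gaug F a \<noteq> 0\<close>. Were it a boundary, the coefficient at \<open>u\<close>,
  weighted by the augmentation, would only involve the constant terms of the differential, and these
  cancel because the augmentation kills boundaries.
\<close>

lemma Tor_nonzero_generator:
  fixes A :: "('n::finite \<Rightarrow>\<^sub>0 nat) set"
  assumes u: "u \<in> A" and A: "\<And>v. v \<in> A \<Longrightarrow> mdeg v = d"
  shows "Tor_nonzero 0 (mon_span (up A) :: ('n, 'a::comm_ring_1) mpoly set) (int d)"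
  unfolding Tor_nonzero_def
proof
  let ?F = "residue_field_resolution :: ('n, 'a) graded_free_complex"
  let ?I = "mon_span (up A) :: ('n, 'a) mpoly set"
  let ?B = "tensor_boundaries ?F ?I 0 (int d)"
  note F = residue_field_resolution_is_resolution[where 'n = 'n and 'a = 'a]
  assume Tor: "Tor 0 ?I (int d) = {?B}"
  then have B: "(\<lambda>b a. z a + b a) ` ?B = ?B" if "z \<in> chains ?F (up A) 0 (int d)" for z
  proof -
    have "(\<lambda>b a. z a + b a) ` ?B \<in> Tor 0 ?I (int d)"
      unfolding Tor_def Let_def using that by (intro imageI) (simp add: chains_def)
    then show ?thesis using Tor by simp
  qed
  have "(1::'a) \<in> augmentation ?F ` free_module ?F 0"
    using F by (simp add: graded_free_resolution_def)
  then obtain v where "augmentation ?F v = (1::'a)" by (metis imageE)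
  then have "\<exists>a\<in>gbasis ?F 0. gaug ?F a \<noteq> (0::'a)"
    unfolding augmentation_def by (rule contrapos_pp) simp
  then obtain a where a: "a \<in> gbasis ?F 0" "gaug ?F a \<noteq> (0::'a)" by blast
  have fin: "finite (gbasis ?F i)" for i using F by (simp add: graded_free_resolution_def)
  define z where "z b = (if b = a then monomial u else (0 :: ('n, 'a) mpoly))" for b
  have z: "z \<in> chains ?F (up A) 0 (int d)"
    unfolding mem_chains_iff z_def
    using a(1) res_aug_degree[OF F a] up_superset[of A] u A[OF u] by auto
  have "bd ?F 0 (\<lambda>_. 0) \<in> ?B"
    unfolding tensor_boundaries_def by (rule imageI) (simp add: tensor_chains_def free_module_0)
  then have "z \<in> (\<lambda>b a. z a + b a) ` ?B"
    by (rule rev_image_eqI) (simp add: bd_zero)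
  then obtain w where w: "w \<in> chains ?F (up A) (Suc 0) (int d)" "z = bd ?F 0 w"
    unfolding B[OF z] by (auto simp: tensor_boundaries_def chains_def)
  have cycle: "(\<Sum>b\<in>gbasis ?F 0. lookup (gdiff ?F 0 c b) 0 * gaug ?F b) = (0::'a)"
    if c: "c \<in> gbasis ?F (Suc 0)" for c
  proof -
    define y where "y b = (if b = c then 1 else (0 :: ('n, 'a) mpoly))" for b
    have "y \<in> free_module ?F 1" using c by (simp add: y_def free_module_def)
    then have "augmentation ?F (bd ?F 0 y) = 0" using res_exact_0[OF F] by blast
    moreover have "bd ?F 0 y b = gdiff ?F 0 c b" if "b \<in> gbasis ?F 0" for b
    proof -
      have "bd ?F 0 y b = (\<Sum>x\<in>gbasis ?F (Suc 0). if x = c then gdiff ?F 0 c b else 0)"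
        unfolding bd_def using that by (auto simp: y_def intro!: sum.cong)
      then show ?thesis using c fin by simp
    qed
    ultimately show ?thesis by (simp add: augmentation_def)
  qed
  have "mdeg u \<le> mdeg m" if "m \<in> keys (w c)" for c m
  proof -
    have "m \<in> up A" using w(1) that unfolding mem_chains_iff by blast
    then obtain v k where "v \<in> A" "m = v + k" unfolding up_def by blast
    then show ?thesis using A u by (simp add: mdeg_add)
  qed
  then have mult: "lookup (w c * g) u = lookup (w c) u * lookup g 0" for c g
    by (rule lookup_mult_initial_degree)
  have "(\<Sum>b\<in>gbasis ?F 0. lookup (z b) u * gaug ?F b) =
      (\<Sum>b\<in>gbasis ?F 0. if b = a then gaug ?F a else 0)"
    by (intro sum.cong) (auto simp: z_def monomial_def)
  then have "gaug ?F a = (\<Sum>b\<in>gbasis ?F 0. lookup (z b) u * gaug ?F b)"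
    using a(1) fin by simp
  also have "\<dots> = (\<Sum>b\<in>gbasis ?F 0. \<Sum>c\<in>gbasis ?F (Suc 0).
      lookup (w c) u * (lookup (gdiff ?F 0 c b) 0 * gaug ?F b))"
    by (intro sum.cong) (simp_all add: w(2) bd_def lookup_sum mult sum_distrib_right mult.assoc)
  also have "\<dots> = (\<Sum>c\<in>gbasis ?F (Suc 0). lookup (w c) u *
      (\<Sum>b\<in>gbasis ?F 0. lookup (gdiff ?F 0 c b) 0 * gaug ?F b))"
    by (subst sum.swap) (simp add: sum_distrib_left)
  also have "\<dots> = 0" using cycle by simp
  finally show False using a(2) by simp
qed

theorem reg_linear_quotients:
  fixes A :: "('n::{finite,linorder} \<Rightarrow>\<^sub>0 nat) set"
  assumes "finite A" "A \<noteq> {}" "lex_linear_quotients A" "\<And>u. u \<in> A \<Longrightarrow> mdeg u = d"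
  shows "reg (mon_span (up A) :: ('n, 'a::comm_ring_1) mpoly set) = int d"
proof -
  let ?I = "mon_span (up A) :: ('n, 'a) mpoly set"
  have vanish: "j - int i = int d" if "Tor_nonzero i ?I j" for i j
  proof (rule ccontr)
    assume "j - int i \<noteq> int d"
    then have "rel_acyclic (residue_field_resolution :: ('n, 'a) graded_free_complex) (up A) {} i j"
      using assms by (intro rel_acyclic_linear_quotients residue_field_resolution_is_resolution) auto
    then show False using that not_Tor_nonzeroI by blast
  qed
  obtain u where "u \<in> A" using assms(2) by blast
  then have "Tor_nonzero 0 ?I (int d)" using assms(4) by (rule Tor_nonzero_generator)
  then have "{j - int i | i j. Tor_nonzero i ?I j} = {int d}"
    using vanish by force
  then show ?thesis by (simp add: reg_def)
qed

section \<open>Minimal generators and the gradient ideal\<close>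

definition monomial_gradient :: "('n \<Rightarrow>\<^sub>0 nat) set \<Rightarrow> ('n \<Rightarrow>\<^sub>0 nat) set" where
  "monomial_gradient A = {u - single i 1 | u i. u \<in> A \<and> i \<in> keys u}"

lemma up_equidegree:
  assumes "\<And>u. u \<in> A \<Longrightarrow> mdeg u = d" "m \<in> up A"
  shows "d \<le> mdeg m" and "mdeg m = d \<Longrightarrow> m \<in> A"
proof -
  obtain a c where ac: "a \<in> A" "m = a + c" using assms(2) unfolding up_def by blast
  then show "d \<le> mdeg m" using assms(1) by (auto simp: mdeg_add)
  assume "mdeg m = d"
  then have "mdeg c = 0" using ac assms(1)[of a] by (simp add: mdeg_add)
  then show "m \<in> A" using ac by (simp add: mdeg_eq_0_iff)
qed

text \<open>
  The minimal elements of \<open>M\<close> for divisibility.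
\<close>

definition minimal_monomials :: "('n \<Rightarrow>\<^sub>0 nat) set \<Rightarrow> ('n \<Rightarrow>\<^sub>0 nat) set" where
  "minimal_monomials M = {m \<in> M. \<forall>a\<in>M. (\<forall>i. lookup a i \<le> lookup m i) \<longrightarrow> a = m}"

lemma up_minimal_monomials:
  fixes M :: "('n::finite \<Rightarrow>\<^sub>0 nat) set"
  assumes "up_closed M"
  shows "up (minimal_monomials M) = M"
proof
  show "up (minimal_monomials M) \<subseteq> M"
    by (rule up_least) (auto simp: minimal_monomials_def assms)
  have "\<exists>a\<in>minimal_monomials M. \<forall>i. lookup a i \<le> lookup m i" if "m \<in> M" for m
    using that
  proof (induction "mdeg m" arbitrary: m rule: less_induct)
    case less
    show ?case
    proof (cases "m \<in> minimal_monomials M")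
      case False
      then obtain a where a: "a \<in> M" "\<forall>i. lookup a i \<le> lookup m i" "a \<noteq> m"
        using less.prems unfolding minimal_monomials_def by blast
      then have "mdeg a \<noteq> mdeg m" using mon_le_same_degree_eqI[of a m] by blast
      moreover have "mdeg a \<le> mdeg m" unfolding mdeg_def using a(2) by (intro sum_mono) simp
      ultimately obtain b where "b \<in> minimal_monomials M" "\<forall>i. lookup b i \<le> lookup a i"
        using less.hyps[of a] a(1) by auto
      then show ?thesis using a(2) order_trans by blast
    qed auto
  qed
  then show "M \<subseteq> up (minimal_monomials M)" by (auto simp: mem_up_iff)
qed

lemma minimal_monomials_subset:
  assumes "up B = M"
  shows "minimal_monomials M \<subseteq> B"
proof
  fix m assume m: "m \<in> minimal_monomials M"
  then have "m \<in> up B" using assms by (simp add: minimal_monomials_def)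
  then obtain b where b: "b \<in> B" "\<forall>i. lookup b i \<le> lookup m i" unfolding mem_up_iff by blast
  then have "b \<in> M" using assms up_superset by blast
  then show "m \<in> B" using b m unfolding minimal_monomials_def by blast
qed

lemma minimal_monomials_equidegree:
  assumes "\<And>u. u \<in> A \<Longrightarrow> mdeg u = d"
  shows "minimal_monomials (up A) = A"
proof
  show "minimal_monomials (up A) \<subseteq> A" by (rule minimal_monomials_subset) simp
  show "A \<subseteq> minimal_monomials (up A)"
  proof
    fix u assume u: "u \<in> A"
    have "a = u" if a: "a \<in> up A" "\<forall>i. lookup a i \<le> lookup u i" for a
    proof -
      have "mdeg a \<le> mdeg u" unfolding mdeg_def using a(2) by (intro sum_mono) simp
      then have "mdeg a = mdeg u"
        using up_equidegree(1)[OF assms a(1)] assms[OF u] by simp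
      then show ?thesis using mon_le_same_degree_eqI[of a u] a(2) by blast
    qed
    then show "u \<in> minimal_monomials (up A)"
      using u up_superset unfolding minimal_monomials_def by blast
  qed
qed

lemma mon_gens_mon_span:
  fixes M :: "('n::finite \<Rightarrow>\<^sub>0 nat) set"
  assumes M: "up_closed M"
  shows "mon_gens (mon_span M :: ('n, 'a::comm_ring_1) mpoly set) = minimal_monomials M"
proof -
  have *: "ideal_gen (monomial ` A) = (mon_span M :: ('n, 'a) mpoly set) \<longleftrightarrow> up A = M" for A
    by (simp add: ideal_gen_monomials mon_span_inject)
  show ?thesis
    unfolding mon_gens_def *
  proof (rule the_equality)
    show "up (minimal_monomials M) = M \<and> (\<forall>B\<subset>minimal_monomials M. up B \<noteq> M)"
      using up_minimal_monomials[OF M] minimal_monomials_subset by blast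
    show "A = minimal_monomials M" if "up A = M \<and> (\<forall>B\<subset>A. up B \<noteq> M)" for A
      using that up_minimal_monomials[OF M] minimal_monomials_subset[of A M] by blast
  qed
qed

lemma mon_gens_equidegree:
  fixes A :: "('n::finite \<Rightarrow>\<^sub>0 nat) set"
  assumes "\<And>u. u \<in> A \<Longrightarrow> mdeg u = d"
  shows "mon_gens (mon_span (up A) :: ('n, 'a::comm_ring_1) mpoly set) = A"
  unfolding mon_gens_mon_span[OF up_closed_up] by (rule minimal_monomials_equidegree[OF assms])

lemma monomial_ideal_mon_gens:
  fixes I :: "('n::finite, 'a::comm_ring_1) mpoly set"
  assumes "monomial_ideal I"
  shows "mon_span (up (mon_gens I)) = I"
proof -
  obtain A where A: "I = mon_span (up A)"
    using assms by (auto simp: monomial_ideal_def ideal_gen_monomials)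
  show ?thesis
    unfolding A mon_gens_mon_span[OF up_closed_up] up_minimal_monomials[OF up_closed_up] ..
qed

text \<open>
  The coefficientwise form makes additivity evident, which the defining sum over the keys of \<open>f\<close> hides.
\<close>

lemma lookup_partial_deriv:
  fixes f :: "('n, 'a::comm_ring_1) mpoly"
  shows "lookup (partial_deriv i f) m = of_nat (lookup m i + 1) * lookup f (m + single i 1)"
proof -
  have *: "k - single i 1 = m \<longleftrightarrow> k = m + single i 1" if "0 < lookup k i" for k
  proof
    assume "k - single i 1 = m"
    then show "k = m + single i 1"
      using that by (intro poly_mapping_eqI) (auto simp: lookup_add lookup_minus lookup_single when_def)
  qed simp
  have "lookup (partial_deriv i f) m =
      (\<Sum>k\<in>keys f. if k - single i 1 = m then of_nat (lookup k i) * lookup f k else 0)"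
    by (simp add: partial_deriv_def lookup_sum lookup_single when_def)
  also have "\<dots> = (\<Sum>k\<in>keys f. if k = m + single i 1 then of_nat (lookup k i) * lookup f k else 0)"
  proof (intro sum.cong refl)
    fix k
    show "(if k - single i 1 = m then of_nat (lookup k i) * lookup f k else 0) =
      (if k = m + single i 1 then of_nat (lookup k i) * lookup f k else 0)"
      using *[of k] by (cases "lookup k i = 0") (auto simp: lookup_add)
  qed
  also have "\<dots> = of_nat (lookup m i + 1) * lookup f (m + single i 1)"
    by (auto simp: in_keys_iff lookup_add)
  finally show ?thesis .
qed

lemma lookup_scalar_mult:
  fixes f :: "('n, 'a::comm_ring_1) mpoly"
  shows "lookup (single 0 c * f) m = c * lookup f m"
  by (simp add: lookup_single_mult)

lemma partial_deriv_0: "partial_deriv i 0 = 0"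
  by (simp add: partial_deriv_def)

lemma partial_deriv_combination:
  "partial_deriv i (single 0 c * f + g) = single 0 c * partial_deriv i f + partial_deriv i g"
  by (rule poly_mapping_eqI)
     (simp add: lookup_partial_deriv lookup_add lookup_scalar_mult distrib_left mult.left_commute
        del: of_nat_add of_nat_Suc)

text \<open>
  The span over the coefficient ring. It matters because partial derivatives are linear over the
  coefficients but not over the polynomial ring.
\<close>

inductive_set scalar_span :: "('n, 'a::comm_ring_1) mpoly set \<Rightarrow> ('n, 'a) mpoly set" for G where
  zero: "0 \<in> scalar_span G"
| step: "f \<in> G \<Longrightarrow> g \<in> scalar_span G \<Longrightarrow> single 0 c * f + g \<in> scalar_span G"

lemma scalar_span_ideal_gen: "f \<in> scalar_span G \<Longrightarrow> f \<in> ideal_gen G"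
  by (induction rule: scalar_span.induct)
     (auto intro: ideal_gen_0 ideal_gen_add ideal_gen_mult subsetD[OF ideal_gen_base])

lemma scalar_span_partial_deriv:
  "f \<in> scalar_span G \<Longrightarrow> partial_deriv i f \<in> scalar_span (partial_deriv i ` G)"
  by (induction rule: scalar_span.induct)
     (auto simp: partial_deriv_0 partial_deriv_combination intro: scalar_span.intros)

text \<open>
  In the lowest possible degree \<open>d\<close>, only constants can multiply the generators of degree \<open>d\<close>, and the
  generators of higher degree contribute nothing.
\<close>

lemma initial_degree_scalar_span:
  fixes G :: "('n::finite, 'a::comm_ring_1) mpoly set"
  assumes hom: "\<And>f. f \<in> G \<Longrightarrow> \<exists>e. homogeneous e f"
    and deg: "\<And>f m. f \<in> G \<Longrightarrow> m \<in> keys f \<Longrightarrow> d \<le> mdeg m"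
    and g: "g \<in> ideal_gen G"
  shows "trunc (\<lambda>m. mdeg m = d) g \<in> scalar_span {f \<in> G. homogeneous d f}"
proof -
  interpret module "(*) :: ('n, 'a) mpoly \<Rightarrow> _" by (rule module_mult)
  show ?thesis
    using g unfolding ideal_gen_def
  proof (induction rule: span_induct_alt)
    case base
    have "trunc (\<lambda>m. mdeg m = d) 0 = (0 :: ('n, 'a) mpoly)" by (simp add: trunc_def)
    then show ?case by (simp add: scalar_span.zero)
  next
    case (step r f g)
    obtain e where e: "homogeneous e f" using hom step by blast
    have lk: "lookup (r * f) m = lookup r 0 * lookup f m" if "mdeg m = d" for m
      using lookup_mult_initial_degree[of f m r] deg[OF step(1)] that by (simp add: mult.commute)
    show ?case
    proof (cases "homogeneous d f")
      case True
      have "trunc (\<lambda>m. mdeg m = d) (r * f) = single 0 (lookup r 0) * f"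
      proof (rule poly_mapping_eqI)
        fix m
        have "lookup f m = 0" if "mdeg m \<noteq> d"
          using True that unfolding homogeneous_def by (auto simp: in_keys_iff)
        then show "lookup (trunc (\<lambda>m. mdeg m = d) (r * f)) m = lookup (single 0 (lookup r 0) * f) m"
          by (cases "mdeg m = d") (simp_all add: lookup_trunc lk lookup_scalar_mult)
      qed
      then show ?thesis
        using True step by (auto simp: trunc_add intro: scalar_span.step)
    next
      case False
      then have "e \<noteq> d" using e by blast
      then have "lookup f m = 0" if "mdeg m = d" for m
        using e that unfolding homogeneous_def by (auto simp: in_keys_iff)
      then have "trunc (\<lambda>m. mdeg m = d) (r * f) = 0"
        by (intro poly_mapping_eqI) (auto simp: lookup_trunc lk)
      then show ?thesis using step by (simp add: trunc_add)
    qed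
  qed
qed

context
  fixes A :: "('n::finite \<Rightarrow>\<^sub>0 nat) set" and d :: nat and I :: "('n, 'a::field) mpoly set"
  assumes A: "\<And>u. u \<in> A \<Longrightarrow> mdeg u = d" "A \<noteq> {}" and I: "I = mon_span (up A)"
begin

text \<open>
  Monomials of equal degree do not divide one another, so none of them is redundant.
\<close>

lemma min_hom_gens_monomials: "min_hom_gens I (monomial ` A)"
  unfolding min_hom_gens_def
proof (intro conjI ballI allI impI)
  fix f assume "f \<in> (monomial ` A :: ('n, 'a) mpoly set)"
  then show "\<exists>d. homogeneous d f" by (auto simp: homogeneous_def)
next
  show "ideal_gen (monomial ` A) = I" unfolding I by (rule ideal_gen_monomials)
next
  fix H :: "('n, 'a) mpoly set" assume H: "H \<subset> monomial ` A"
  then obtain B where B: "B \<subseteq> A" "H = monomial ` B" by (metis psubset_imp_subset subset_image_iff)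
  show "ideal_gen H \<noteq> I"
  proof
    assume "ideal_gen H = I"
    then have "up B = up A" by (simp add: I B(2) ideal_gen_monomials mon_span_inject)
    then have "A \<subseteq> B" using minimal_monomials_subset minimal_monomials_equidegree A(1) by metis
    then show False using B H by blast
  qed
qed

lemma min_hom_gens_scalar_span:
  assumes G: "min_hom_gens I G" and u: "u \<in> A"
  shows "monomial u \<in> scalar_span {f \<in> G. homogeneous d f}"
proof -
  have sub: "G \<subseteq> I" using G ideal_gen_base unfolding min_hom_gens_def by blast
  have "trunc (\<lambda>m. mdeg m = d) (monomial u) \<in> scalar_span {f \<in> G. homogeneous d f}"
  proof (rule initial_degree_scalar_span)
    show "\<exists>e. homogeneous e f" if "f \<in> G" for f
      using G that by (simp add: min_hom_gens_def)
    show "d \<le> mdeg m" if "f \<in> G" "m \<in> keys f" for f m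
      using sub that up_equidegree(1)[OF A(1)] unfolding I mon_span_def by blast
    show "monomial u \<in> ideal_gen G"
      using G u up_superset[of A] by (auto simp: min_hom_gens_def I)
  qed
  moreover have "trunc (\<lambda>m. mdeg m = d) (monomial u) = (monomial u :: ('n, 'a) mpoly)"
    using A(1)[OF u] by (intro poly_mapping_eqI)
      (auto simp: lookup_trunc monomial_def lookup_single when_def)
  ultimately show ?thesis by simp
qed

text \<open>
  The generators of degree \<open>d\<close> already generate \<open>I\<close>, so a minimal generating set contains no others.
\<close>

lemma min_hom_gens_homogeneous:
  assumes G: "min_hom_gens I G" and f: "f \<in> G"
  shows "homogeneous d f"
proof (rule ccontr)
  let ?H = "{f \<in> G. homogeneous d f}"
  assume "\<not> homogeneous d f"
  then have "?H \<subset> G" using f by blast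
  then have ne: "ideal_gen ?H \<noteq> I" using G by (simp add: min_hom_gens_def)
  have "monomial ` A \<subseteq> ideal_gen ?H"
    using min_hom_gens_scalar_span[OF G] scalar_span_ideal_gen by blast
  then have "I \<subseteq> ideal_gen ?H"
    unfolding I ideal_gen_monomials[symmetric] by (rule ideal_gen_subset)
  moreover have "?H \<subseteq> ideal_gen G" using ideal_gen_base by blast
  then have "ideal_gen ?H \<subseteq> I" using ideal_gen_subset G by (auto simp: min_hom_gens_def)
  ultimately show False using ne by blast
qed

text \<open>
  The zero polynomial is homogeneous of every degree, so its presence would spoil the initial degree.
\<close>

lemma zero_notin_min_hom_gens: "min_hom_gens I G \<Longrightarrow> 0 \<notin> G"
proof
  assume G: "min_hom_gens I G" and "0 \<in> G"
  then have "ideal_gen (G - {0}) \<noteq> I" by (auto simp: min_hom_gens_def)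
  moreover have "G \<subseteq> ideal_gen (G - {0})"
    using ideal_gen_base[of "G - {0}"] ideal_gen_0[of "G - {0}"] by blast
  then have "ideal_gen G \<subseteq> ideal_gen (G - {0})" by (rule ideal_gen_subset)
  moreover have "G - {0} \<subseteq> ideal_gen G" using ideal_gen_base by blast
  then have "ideal_gen (G - {0}) \<subseteq> ideal_gen G" by (rule ideal_gen_subset)
  ultimately show False using G by (auto simp: min_hom_gens_def)
qed

lemma initial_degree_equidegree: "initial_degree I = d"
  unfolding initial_degree_def
proof (rule Least_equality)
  obtain u where u: "u \<in> A" using A(2) by blast
  then have "homogeneous d (monomial u :: ('n, 'a) mpoly)" using A(1) by (simp add: homogeneous_def)
  then show "\<exists>G. min_hom_gens I G \<and> (\<exists>f\<in>G. homogeneous d f)"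
    using min_hom_gens_monomials u by blast
next
  fix e assume "\<exists>G. min_hom_gens I G \<and> (\<exists>f\<in>G. homogeneous e f)"
  then obtain G f where G: "min_hom_gens I G" "f \<in> G" "homogeneous e f" by blast
  then have "f \<noteq> 0" using zero_notin_min_hom_gens by blast
  then obtain m where "m \<in> keys f" by (metis keys_eq_empty ex_in_conv)
  then show "d \<le> e" using G(3) min_hom_gens_homogeneous[OF G(1,2)] by (auto simp: homogeneous_def)
qed

text \<open>
  A minimal generating set \<open>G\<close> and \<open>A\<close> span the same forms of degree \<open>d\<close>, hence so do their partial
  derivatives; and \<open>\<partial>\<^sub>i x\<^sup>u\<close> is \<open>u\<^sub>i x\<^sup>u / x\<^sub>i\<close>, where \<open>u\<^sub>i\<close> is invertible when \<open>x\<^sub>i\<close> divides \<open>x\<^sup>u\<close>.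
\<close>

lemma gradient_ideal_char_0:
  assumes char: "CHAR('a) = 0"
  shows "gradient_ideal I = mon_span (up (monomial_gradient A))"
proof -
  define G where "G = (SOME G. min_hom_gens I G)"
  have G: "min_hom_gens I G" unfolding G_def using min_hom_gens_monomials by (rule someI)
  let ?D = "{partial_deriv i f | i f. f \<in> G}"
  have "gradient_ideal I = ideal_gen ?D" by (simp add: gradient_ideal_def G_def Let_def)
  also have "\<dots> = ideal_gen (monomial ` monomial_gradient A)"
  proof (rule antisym; rule ideal_gen_subset)
    show "?D \<subseteq> ideal_gen (monomial ` monomial_gradient A)"
    proof clarify
      fix i f assume f: "f \<in> G"
      have "keys (partial_deriv i f) \<subseteq> monomial_gradient A"
      proof
        fix m assume "m \<in> keys (partial_deriv i f)"
        then have "m + single i 1 \<in> keys f"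
          unfolding in_keys_iff lookup_partial_deriv by (metis mult_zero_right)
        moreover have "keys f \<subseteq> up A"
          using G f ideal_gen_base[of G] by (auto simp: min_hom_gens_def I mon_span_def)
        ultimately have "m + single i 1 \<in> A"
          using min_hom_gens_homogeneous[OF G f] up_equidegree(2)[OF A(1)]
          by (auto simp: homogeneous_def)
        moreover have "m = m + single i 1 - single i 1" "i \<in> keys (m + single i 1)"
          by (simp_all add: in_keys_iff lookup_add)
        ultimately show "m \<in> monomial_gradient A" unfolding monomial_gradient_def by blast
      qed
      then show "partial_deriv i f \<in> ideal_gen (monomial ` monomial_gradient A)"
        using up_superset[of "monomial_gradient A"] by (auto simp: ideal_gen_monomials mon_span_def)
    qed
    show "monomial ` monomial_gradient A \<subseteq> ideal_gen ?D"
    proof clarify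
      fix m assume "m \<in> monomial_gradient A"
      then obtain u i where u: "m = u - single i 1" "u \<in> A" "i \<in> keys u"
        unfolding monomial_gradient_def by blast
      have "partial_deriv i (monomial u) \<in> scalar_span (partial_deriv i ` {f \<in> G. homogeneous d f})"
        using min_hom_gens_scalar_span[OF G u(2)] by (rule scalar_span_partial_deriv)
      then have "partial_deriv i (monomial u) \<in> ideal_gen (partial_deriv i ` {f \<in> G. homogeneous d f})"
        by (rule scalar_span_ideal_gen)
      moreover have "partial_deriv i ` {f \<in> G. homogeneous d f} \<subseteq> ideal_gen ?D"
        using ideal_gen_base[of ?D] by blast
      ultimately have "partial_deriv i (monomial u) \<in> ideal_gen ?D"
        using ideal_gen_subset by blast
      then have "single 0 (inverse (of_nat (lookup u i))) * partial_deriv i (monomial u) \<in> ideal_gen ?D"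
        by (rule ideal_gen_mult)
      moreover have "of_nat (lookup u i) \<noteq> (0::'a)"
        using u(3) char by (simp add: of_nat_eq_0_iff_char_dvd in_keys_iff)
      then have "single 0 (inverse (of_nat (lookup u i))) * partial_deriv i (monomial u) =
          (monomial m :: ('n, 'a) mpoly)"
        by (simp add: partial_deriv_def monomial_def mult_single u(1))
      ultimately show "monomial m \<in> ideal_gen ?D" by simp
    qed
  qed
  also have "\<dots> = mon_span (up (monomial_gradient A))" by (rule ideal_gen_monomials)
  finally show ?thesis .
qed

end

section \<open>Stable sets of monomials\<close>

definition stable_monomials :: "('n::linorder \<Rightarrow>\<^sub>0 nat) set \<Rightarrow> bool" where
  "stable_monomials A \<longleftrightarrow> (\<forall>u\<in>A. u \<noteq> 0 \<longrightarrow>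
     (\<forall>i < Max (keys u). u - single (Max (keys u)) 1 + single i 1 \<in> A))"

text \<open>
  Let \<open>k\<close> be the first place where \<open>u < v\<close> differ. If \<open>u\<close> had no variable beyond \<open>k\<close>, it would divide
  \<open>v\<close> and so equal it. Hence the last variable of \<open>u\<close> lies beyond \<open>k\<close> and stability exchanges it for
  \<open>x\<^sub>k\<close>.
\<close>

lemma stable_linear_quotients:
  fixes A :: "('n::{finite,linorder} \<Rightarrow>\<^sub>0 nat) set"
  assumes "stable_monomials A" and deg: "\<And>u. u \<in> A \<Longrightarrow> mdeg u = d"
  shows "lex_linear_quotients A"
  unfolding lex_linear_quotients_def
proof (intro ballI impI)
  fix u v assume u: "u \<in> A" and v: "v \<in> A" and "u < v"
  then obtain k where k: "lookup u k < lookup v k" "\<And>l. l < k \<Longrightarrow> lookup u l = lookup v l"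
    unfolding lex_less_iff by blast
  have "\<exists>j>k. 0 < lookup u j"
  proof (rule ccontr)
    assume none: "\<not> (\<exists>j>k. 0 < lookup u j)"
    have "lookup u l \<le> lookup v l" for l
      using k none by (cases l k rule: linorder_cases) auto
    then have "u = v" using deg[OF u] deg[OF v] by (intro mon_le_same_degree_eqI) simp_all
    then show False using k(1) by simp
  qed
  then obtain j where j: "k < j" "j \<in> keys u" by (auto simp: in_keys_iff)
  then have "u \<noteq> 0" by auto
  have max: "Max (keys u) \<in> keys u" "j \<le> Max (keys u)"
    using j(2) by (auto intro: Max_in)
  then have "k < Max (keys u)" using j(1) by simp
  then have "u - single (Max (keys u)) 1 + single k 1 \<in> A"
    using assms(1) u \<open>u \<noteq> 0\<close> unfolding stable_monomials_def by blast
  then show "\<exists>i j. i < j \<and> lookup u i < lookup v i \<and> 0 < lookup u j \<and>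
      u - single j 1 + single i 1 \<in> A"
    using \<open>k < Max (keys u)\<close> k(1) max(1) by (metis in_keys_iff gr_zeroI)
qed

text \<open>
  Let \<open>v = u / x\<^sub>i\<close> with last variable \<open>x\<^sub>m\<close>. If \<open>i \<le> m\<close>, then \<open>x\<^sub>m\<close> is also the last variable of \<open>u\<close> and
  the exchange in \<open>u\<close> commutes with the division by \<open>x\<^sub>i\<close>. Otherwise \<open>x\<^sub>i\<close> is the last variable of \<open>u\<close>;
  exchanging it for \<open>x\<^sub>k\<close> and dividing by \<open>x\<^sub>m\<close> gives the same monomial as exchanging \<open>x\<^sub>m\<close> for \<open>x\<^sub>k\<close>
  in \<open>v\<close>.
\<close>

lemma stable_gradient:
  assumes A: "stable_monomials A"
  shows "stable_monomials (monomial_gradient A)"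
  unfolding stable_monomials_def
proof (intro ballI impI allI)
  fix v k assume "v \<in> monomial_gradient A" "v \<noteq> 0" and k: "k < Max (keys v)"
  then obtain u i where u: "v = u - single i 1" "u \<in> A" "i \<in> keys u"
    unfolding monomial_gradient_def by blast
  define m where "m = Max (keys v)"
  have lv: "lookup v j = lookup u j - (if j = i then 1 else 0)" for j
    by (simp add: u(1) lookup_minus lookup_single when_def)
  have m: "m \<in> keys v" "\<And>j. j \<in> keys v \<Longrightarrow> j \<le> m"
    unfolding m_def using \<open>v \<noteq> 0\<close> by (auto intro!: Max_in)
  have keys_u: "j \<le> m \<or> j = i" if "j \<in> keys u" for j
    using m(2)[of j] that by (auto simp: in_keys_iff lv)
  have km: "k < m" using k by (simp add: m_def)
  have "u \<noteq> 0" using u(3) by auto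
  show "v - single (Max (keys v)) 1 + single k 1 \<in> monomial_gradient A"
    unfolding m_def[symmetric]
  proof (cases "i \<le> m")
    case True
    have "m \<in> keys u" using m(1) by (auto simp: in_keys_iff lv)
    then have "Max (keys u) = m"
      using keys_u True by (intro Max_eqI) auto
    then have u': "u - single m 1 + single k 1 \<in> A"
      using A u(2) km \<open>u \<noteq> 0\<close> unfolding stable_monomials_def by blast
    have "i \<in> keys (u - single m 1 + single k 1)"
      using u(3) m(1) unfolding in_keys_iff lookup_exchange by (auto simp: lv)
    moreover have "v - single m 1 + single k 1 = u - single m 1 + single k 1 - single i 1"
      using u(3) m(1) km
      by (intro poly_mapping_eqI)
        (auto simp: u(1) lookup_add lookup_minus lookup_single when_def in_keys_iff)
    ultimately show "v - single m 1 + single k 1 \<in> monomial_gradient A"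
      using u' unfolding monomial_gradient_def by blast
  next
    case False
    then have "Max (keys u) = i"
      using keys_u u(3) by (intro Max_eqI) fastforce+
    then have u': "u - single i 1 + single k 1 \<in> A"
      using A u(2) km False \<open>u \<noteq> 0\<close> unfolding stable_monomials_def by (metis less_trans not_le)
    have "m \<in> keys (u - single i 1 + single k 1)"
      using m(1) False unfolding in_keys_iff lookup_exchange by (auto simp: lv)
    moreover have "v - single m 1 + single k 1 = u - single i 1 + single k 1 - single m 1"
      using m(1) km False
      by (intro poly_mapping_eqI)
        (auto simp: u(1) lookup_add lookup_minus lookup_single when_def in_keys_iff)
    ultimately show "v - single m 1 + single k 1 \<in> monomial_gradient A"
      using u' unfolding monomial_gradient_def by blast
  qed
qed

section \<open>Polymatroids\<close>

lemma polymatroid_down: "discrete_polymatroid P \<Longrightarrow> u \<in> P \<Longrightarrow> v \<le> u \<Longrightarrow> v \<in> P"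
  unfolding discrete_polymatroid_def by blast

lemma polymatroid_augment:
  assumes P: "discrete_polymatroid P" "u \<in> P" "v \<in> P" and lt: "sum u UNIV < sum v UNIV"
  obtains i where "u i < v i" "u(i := u i + 1) \<in> P"
proof -
  have "\<forall>u\<in>P. \<forall>v\<in>P. sum u UNIV < sum v UNIV \<longrightarrow> (\<exists>w\<in>P. u < w \<and> w \<le> sup u v)"
    using P(1) by (simp add: discrete_polymatroid_def)
  then have "\<exists>w\<in>P. u < w \<and> w \<le> sup u v" using P(2,3) lt by simp
  then obtain w where w: "w \<in> P" "u < w" "w \<le> sup u v" by (elim bexE conjE)
  have "u \<le> w" "\<not> w \<le> u" using w(2) by auto
  then have "\<exists>i. u i < w i" by (simp add: le_fun_def not_le)
  then obtain i where i: "u i < w i" ..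
  have "w i \<le> max (u i) (v i)" using w(3) by (auto simp: le_fun_def sup_max dest: spec[of _ i])
  then have "u i < v i" using i by simp
  moreover have "u(i := u i + 1) \<le> w"
    using \<open>u \<le> w\<close> i by (auto simp: le_fun_def)
  then have "u(i := u i + 1) \<in> P" using polymatroid_down[OF P(1) w(1)] by blast
  ultimately show ?thesis using that by blast
qed

lemma sum_increment:
  fixes f :: "'n::finite \<Rightarrow> nat"
  shows "sum (f(i := f i + 1)) UNIV = Suc (sum f UNIV)"
proof -
  have "sum (f(i := f i + 1)) UNIV = (\<Sum>j\<in>UNIV. f j + (if j = i then 1 else 0))"
    by (intro sum.cong) auto
  then show ?thesis by (simp add: sum.distrib)
qed

lemma polymatroid_extend:
  assumes P: "discrete_polymatroid P" "u \<in> P" "w \<in> P" and le: "sum w UNIV \<le> sum u UNIV"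
  shows "\<exists>w'\<in>P. w \<le> w' \<and> (\<forall>i. w' i \<le> max (w i) (u i)) \<and> sum w' UNIV = sum u UNIV"
  using P(3) le
proof (induction "sum u UNIV - sum w UNIV" arbitrary: w rule: less_induct)
  case less
  show ?case
  proof (cases "sum w UNIV = sum u UNIV")
    case True
    then show ?thesis using less.prems(1) by auto
  next
    case False
    then have lt: "sum w UNIV < sum u UNIV" using less.prems(2) by simp
    then obtain i where i: "w i < u i" "w(i := w i + 1) \<in> P"
      using polymatroid_augment[OF P(1) less.prems(1) P(2)] by blast
    have s: "sum (w(i := w i + 1)) UNIV = Suc (sum w UNIV)" by (rule sum_increment)
    then obtain w' where w': "w' \<in> P" "w(i := w i + 1) \<le> w'"
      "\<forall>j. w' j \<le> max ((w(i := w i + 1)) j) (u j)" "sum w' UNIV = sum u UNIV"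
      using less.hyps[OF _ i(2)] lt by fastforce
    have "w \<le> w(i := w i + 1)" by (simp add: le_fun_def)
    then have "w \<le> w'" using w'(2) by (rule order_trans)
    moreover have "w' j \<le> max (w j) (u j)" for j
      using spec[OF w'(3), of j] i(1) by (auto split: if_splits)
    ultimately show ?thesis using w'(1,4) by blast
  qed
qed

definition truncation :: "('n::finite \<Rightarrow> nat) set \<Rightarrow> nat \<Rightarrow> ('n \<Rightarrow>\<^sub>0 nat) set" where
  "truncation P s = {u. lookup u \<in> P \<and> mdeg u = s}"

text \<open>
  Linear quotients in the lexicographic order need the exchange property in its dual form: the index \<open>k\<close>
  to be increased is prescribed, not the one to be decreased. Extending \<open>min(u, v) + e\<^sub>k \<le> v\<close> inside \<open>P\<close>
  up to size \<open>s\<close> by means of \<open>u\<close> yields a vector below \<open>u + e\<^sub>k\<close>, which must be \<open>u - e\<^sub>j + e\<^sub>k\<close>; and \<open>j\<close>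
  is a place where \<open>v\<^sub>j < u\<^sub>j\<close>, hence it comes after \<open>k\<close>.
\<close>

lemma truncation_linear_quotients:
  fixes P :: "('n::{finite,linorder} \<Rightarrow> nat) set"
  assumes P: "discrete_polymatroid P"
  shows "lex_linear_quotients (truncation P s)"
  unfolding lex_linear_quotients_def
proof (intro ballI impI)
  fix u v assume u: "u \<in> truncation P s" and v: "v \<in> truncation P s" and "u < v"
  then obtain k where k: "lookup u k < lookup v k" "\<And>l. l < k \<Longrightarrow> lookup u l = lookup v l"
    unfolding lex_less_iff by blast
  \<comment> \<open>below \<open>v\<close>, as \<open>k\<close> is a place where \<open>v\<close> exceeds \<open>u\<close>\<close>
  define w where "w = (\<lambda>i. min (lookup u i) (lookup v i))(k := lookup u k + 1)"
  have wv: "w \<le> lookup v" using k(1) by (auto simp: w_def le_fun_def)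
  then have "w \<in> P" using polymatroid_down[OF P] v by (auto simp: truncation_def)
  moreover have "sum w UNIV \<le> sum (lookup u) UNIV"
  proof -
    have "sum w UNIV \<le> sum (lookup v) UNIV" using wv by (intro sum_mono) (auto simp: le_fun_def)
    then show ?thesis using u v by (simp add: truncation_def mdeg_def)
  qed
  ultimately obtain w' where w': "w' \<in> P" "w \<le> w'" "\<And>i. w' i \<le> max (w i) (lookup u i)"
    "sum w' UNIV = sum (lookup u) UNIV"
    using polymatroid_extend[OF P, of "lookup u" w] u by (auto simp: truncation_def)
  define y where "y = Abs_poly_mapping w'"
  have y: "lookup y = w'" by (simp add: y_def)
  have yk: "lookup y k = lookup u k + 1"
    using w'(2) w'(3)[of k] by (auto simp: y w_def le_fun_def dest: spec[of _ k])
  have y_le: "lookup y i \<le> lookup u i" if "i \<noteq> k" for i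
    using w'(3)[of i] that by (simp add: y w_def)
  have y_deg: "mdeg y = mdeg u" using w'(4) by (simp add: mdeg_def y)
  have "\<exists>j. lookup y j < lookup u j"
  proof (rule ccontr)
    assume "\<not> (\<exists>j. lookup y j < lookup u j)"
    then have "u = y" using y_deg by (intro mon_le_same_degree_eqI) (simp_all add: not_less)
    then show False using yk by simp
  qed
  then obtain j where j: "lookup y j < lookup u j" by blast
  then have jk: "j \<noteq> k" using yk by auto
  have "min (lookup u j) (lookup v j) \<le> lookup y j"
    using w'(2) jk by (auto simp: y w_def le_fun_def dest: spec[of _ j])
  then have "lookup v j < lookup u j" using j by simp
  then have "k < j" using k(2)[of j] jk by (metis less_irrefl linorder_neqE)
  have "y = u - single j 1 + single k 1"
  proof (rule mon_le_same_degree_eqI)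
    show "lookup y i \<le> lookup (u - single j 1 + single k 1) i" for i
      using y_le[of i] yk j jk unfolding lookup_exchange by auto
    show "mdeg y = mdeg (u - single j 1 + single k 1)"
      using y_deg mdeg_exchange[of u j k] j by simp
  qed
  moreover have "y \<in> truncation P s"
    using w'(1) y_deg u by (simp add: truncation_def y)
  ultimately show "\<exists>i j. i < j \<and> lookup u i < lookup v i \<and> 0 < lookup u j \<and>
      u - single j 1 + single i 1 \<in> truncation P s"
    using \<open>k < j\<close> k(1) j by (metis gr_zeroI not_less_zero)
qed

lemma lookup_add_single: "lookup (u + single i 1) = (lookup u)(i := lookup u i + 1)"
  by (auto simp: lookup_add lookup_single when_def)

text \<open>
  A vector of size \<open>s\<close> is not maximal as long as \<open>P\<close> has elements of size \<open>s + 1\<close>, so it arises from one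
  of these by lowering a coordinate.
\<close>

lemma truncation_gradient:
  assumes P: "discrete_polymatroid P" and "truncation P (Suc s) \<noteq> {}"
  shows "monomial_gradient (truncation P (Suc s)) = truncation P s"
proof (intro equalityI subsetI)
  fix m assume "m \<in> monomial_gradient (truncation P (Suc s))"
  then obtain u i where u: "m = u - single i 1" "lookup u \<in> P" "mdeg u = Suc s" "i \<in> keys u"
    unfolding monomial_gradient_def truncation_def by blast
  have um: "u = m + single i 1"
    using u(1,4) by (intro poly_mapping_eqI)
      (auto simp: lookup_add lookup_minus lookup_single when_def in_keys_iff)
  then have "lookup m \<le> lookup u" by (simp add: le_fun_def lookup_add)
  then have "lookup m \<in> P" using polymatroid_down[OF P u(2)] by blast
  moreover have "mdeg m = s" using u(3) by (simp add: um mdeg_add mdeg_single del: One_nat_def)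
  ultimately show "m \<in> truncation P s" by (simp add: truncation_def)
next
  fix m assume m: "m \<in> truncation P s"
  obtain v where v: "v \<in> truncation P (Suc s)" using assms(2) by blast
  then obtain i where "(lookup m)(i := lookup m i + 1) \<in> P"
    using polymatroid_augment[OF P, of "lookup m" "lookup v"] m by (auto simp: truncation_def mdeg_def)
  then have "m + single i 1 \<in> truncation P (Suc s)"
    using m unfolding truncation_def lookup_add_single[symmetric]
    by (simp add: mdeg_add mdeg_single)
  moreover have "m = m + single i 1 - single i 1" "i \<in> keys (m + single i 1)"
    by (simp_all add: in_keys_iff lookup_add)
  ultimately show "m \<in> monomial_gradient (truncation P (Suc s))"
    unfolding monomial_gradient_def by blast
qed

text \<open>
  All bases have the same, maximal size, for otherwise a smaller one could be augmented.
\<close>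

lemma polymatroid_bases_truncation:
  assumes P: "discrete_polymatroid P" and A: "lookup ` A = polymatroid_bases P" and b: "b \<in> A"
  shows "A = truncation P (mdeg b)"
proof -
  have base: "u \<in> P" "\<And>v. v \<in> P \<Longrightarrow> \<not> u < v" if "u \<in> polymatroid_bases P" for u
    using that by (auto simp: polymatroid_bases_def)
  have max: "sum v UNIV \<le> sum u UNIV" if u: "u \<in> polymatroid_bases P" and v: "v \<in> P" for u v
  proof (rule ccontr)
    assume "\<not> sum v UNIV \<le> sum u UNIV"
    then obtain i where "u(i := u i + 1) \<in> P"
      using polymatroid_augment[OF P base(1)[OF u] v] by force
    moreover have "\<not> u(i := u i + 1) \<le> u" by (auto simp: le_fun_def intro: exI[of _ i])
    moreover have "u \<le> u(i := u i + 1)" by (simp add: le_fun_def)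
    ultimately have "u(i := u i + 1) \<in> P" "u < u(i := u i + 1)"
      unfolding less_le_not_le by simp_all
    then show False using base(2)[OF u] by blast
  qed
  have bB: "lookup b \<in> polymatroid_bases P" using A b by blast
  have "u \<in> A \<longleftrightarrow> lookup u \<in> P \<and> mdeg u = mdeg b" for u
  proof
    assume "u \<in> A"
    then have uB: "lookup u \<in> polymatroid_bases P" using A by blast
    then show "lookup u \<in> P \<and> mdeg u = mdeg b"
      using max[OF uB base(1)[OF bB]] max[OF bB base(1)[OF uB]] base(1)[OF uB]
      by (simp add: mdeg_def)
  next
    assume u: "lookup u \<in> P \<and> mdeg u = mdeg b"
    have "\<not> lookup u < v" if "v \<in> P" for v
    proof
      assume lt: "lookup u < v"
      have "lookup u \<le> v" "\<not> v \<le> lookup u" using lt by auto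
      then have "\<exists>i. lookup u i < v i" "\<forall>i. lookup u i \<le> v i"
        by (simp_all add: le_fun_def not_le)
      then have "sum (lookup u) UNIV < sum v UNIV" by (intro sum_strict_mono_ex1) auto
      then show False using max[OF bB that] u by (simp add: mdeg_def)
    qed
    then have "lookup u \<in> polymatroid_bases P" using u by (simp add: polymatroid_bases_def)
    then obtain w where "w \<in> A" "lookup w = lookup u" using A by (metis imageE)
    then show "u \<in> A" by (simp add: lookup_inject)
  qed
  then show ?thesis by (auto simp: truncation_def)
qed

section \<open>Differential linear resolutions\<close>

text \<open>
  The invariant of the iteration. In the polymatroidal case the same \<open>P\<close> serves for all iterated gradient
  ideals, only the size \<open>d\<close> decreases.
\<close>

definition polymatroid_or_stable :: "nat \<Rightarrow> ('n::{finite,linorder} \<Rightarrow>\<^sub>0 nat) set \<Rightarrow> bool" where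
  "polymatroid_or_stable d A \<longleftrightarrow> A \<noteq> {} \<and> (\<forall>u\<in>A. mdeg u = d) \<and>
     (stable_monomials A \<or> (\<exists>P. discrete_polymatroid P \<and> A = truncation P d))"

lemma polymatroid_or_stable_gradient:
  assumes A: "polymatroid_or_stable (Suc d) A"
  shows "polymatroid_or_stable d (monomial_gradient A)"
proof -
  have deg: "\<And>u. u \<in> A \<Longrightarrow> mdeg u = Suc d" and "A \<noteq> {}"
    using A by (auto simp: polymatroid_or_stable_def)
  then obtain u where u: "u \<in> A" "mdeg u = Suc d" by blast
  then have "u \<noteq> 0" by (auto simp: mdeg_def)
  then obtain i where "i \<in> keys u" by (metis keys_eq_empty ex_in_conv)
  then have "monomial_gradient A \<noteq> {}" using u(1) unfolding monomial_gradient_def by blast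
  moreover have "mdeg m = d" if m: "m \<in> monomial_gradient A" for m
  proof -
    obtain u i where u: "m = u - single i 1" "u \<in> A" "i \<in> keys u"
      using m unfolding monomial_gradient_def by blast
    have "u = m + single i 1"
      using u(1,3) by (intro poly_mapping_eqI)
        (auto simp: lookup_add lookup_minus lookup_single when_def in_keys_iff)
    then have "mdeg u = mdeg m + 1" by (metis mdeg_add mdeg_single)
    then show ?thesis using deg[OF u(2)] by simp
  qed
  moreover have "stable_monomials (monomial_gradient A) \<or>
      (\<exists>P. discrete_polymatroid P \<and> monomial_gradient A = truncation P d)"
    using A stable_gradient truncation_gradient unfolding polymatroid_or_stable_def by metis
  ultimately show ?thesis unfolding polymatroid_or_stable_def by blast
qed

lemma finite_equidegree:
  fixes A :: "('n::finite \<Rightarrow>\<^sub>0 nat) set"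
  assumes "\<And>u. u \<in> A \<Longrightarrow> mdeg u = d"
  shows "finite A"
proof (rule finite_imageD)
  have "lookup u i \<le> d" if "u \<in> A" for u i
    using assms[OF that] member_le_sum[of i UNIV "lookup u"] by (simp add: mdeg_def)
  then have "lookup ` A \<subseteq> {f. \<forall>x. (x \<in> UNIV \<longrightarrow> f x \<in> {..d}) \<and> (x \<notin> UNIV \<longrightarrow> f x = 0)}"
    by auto
  then show "finite (lookup ` A)"
    by (rule finite_subset) (rule finite_set_of_finite_funs; simp)
  show "inj_on lookup A" by (simp add: inj_on_def lookup_inject)
qed

lemma polymatroid_or_stable_linear_quotients:
  assumes "polymatroid_or_stable d A"
  shows "lex_linear_quotients A"
  using assms stable_linear_quotients truncation_linear_quotients
  unfolding polymatroid_or_stable_def by metis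

lemma iter_gradient_mon_span:
  fixes A :: "('n::{finite,linorder} \<Rightarrow>\<^sub>0 nat) set" and I :: "('n, 'a::field) mpoly set"
  assumes A: "polymatroid_or_stable d A" and I: "I = mon_span (up A)"
    and adm: "admissible_char I" and "l \<le> d"
  shows "polymatroid_or_stable (d - l) ((monomial_gradient ^^ l) A) \<and>
    iter_gradient l I = mon_span (up ((monomial_gradient ^^ l) A))"
  using \<open>l \<le> d\<close>
proof (induction l)
  case 0
  then show ?case using A I by (simp add: iter_gradient_def)
next
  case (Suc l)
  let ?A = "(monomial_gradient ^^ l) A"
  have cls: "polymatroid_or_stable (Suc (d - Suc l)) ?A"
    and J: "iter_gradient l I = mon_span (up ?A)"
    using Suc by (simp_all add: Suc_diff_Suc)
  have deg: "\<And>u. u \<in> ?A \<Longrightarrow> mdeg u = Suc (d - Suc l)" and ne: "?A \<noteq> {}"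
    using cls by (simp_all add: polymatroid_or_stable_def)
  have step: "iter_gradient (Suc l) I = gradient_ideal (iter_gradient l I)"
    by (simp add: iter_gradient_def)
  have "gradient_ideal (iter_gradient l I) = mon_span (up (monomial_gradient ?A))"
  proof (cases "CHAR('a) = 0")
    case True
    show ?thesis by (rule gradient_ideal_char_0[OF deg ne J True])
  next
    case False
    have "initial_degree I = d"
      using A by (intro initial_degree_equidegree[OF _ _ I]) (auto simp: polymatroid_or_stable_def)
    moreover have gens: "mon_gens (iter_gradient l I) = ?A"
      unfolding J by (rule mon_gens_equidegree[OF deg])
    ultimately have "gradient_ideal (iter_gradient l I) =
        ideal_gen {monomial (u - single i 1) | u i. u \<in> ?A \<and> i \<in> keys u}"
      using adm False Suc.prems by (auto simp: admissible_char_def Let_def)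
    also have "{monomial (u - single i 1) | u i. u \<in> ?A \<and> i \<in> keys u} =
        monomial ` monomial_gradient ?A"
      unfolding monomial_gradient_def by blast
    finally show ?thesis by (simp only: ideal_gen_monomials)
  qed
  then show ?case using polymatroid_or_stable_gradient[OF cls] step by simp
qed

lemma polymatroid_or_stable_reg:
  fixes A :: "('n::{finite,linorder} \<Rightarrow>\<^sub>0 nat) set"
  assumes A: "polymatroid_or_stable d A"
  shows "reg (mon_span (up A) :: ('n, 'a::field) mpoly set) = int d"
    and "linear_resolution (mon_span (up A) :: ('n, 'a) mpoly set)"
proof -
  have deg: "\<And>u. u \<in> A \<Longrightarrow> mdeg u = d" and ne: "A \<noteq> {}"
    using A by (simp_all add: polymatroid_or_stable_def)
  show reg: "reg (mon_span (up A) :: ('n, 'a) mpoly set) = int d"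
    by (rule reg_linear_quotients[OF finite_equidegree[OF deg] ne
          polymatroid_or_stable_linear_quotients[OF A] deg])
  show "linear_resolution (mon_span (up A) :: ('n, 'a) mpoly set)"
    unfolding linear_resolution_def
    using reg min_hom_gens_homogeneous[OF deg ne refl] by blast
qed

theorem mainTheorem5:
  fixes I :: "('n::{finite,linorder}, 'a::field) mpoly set"
  assumes "monomial_ideal I"
    and "I \<noteq> {0}"
    and "admissible_char I"
    and "polymatroidal_ideal I \<or> ((stable_ideal I \<or> strongly_stable_ideal I) \<and> equigenerated I)"
  shows "differential_linear_resolution I"
proof -
  define A where "A = mon_gens I"
  have I: "I = mon_span (up A)" unfolding A_def by (rule monomial_ideal_mon_gens[OF assms(1), symmetric])
  have "A \<noteq> {}"
  proof
    assume "A = {}"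
    then have "I = {0}" by (auto simp: I up_def mon_span_def)
    then show False using assms(2) by blast
  qed
  then obtain b where b: "b \<in> A" by blast
  have "\<exists>d. polymatroid_or_stable d A"
    using assms(4)
  proof
    assume "polymatroidal_ideal I"
    then obtain P where P: "discrete_polymatroid P" "lookup ` A = polymatroid_bases P"
      unfolding polymatroidal_ideal_def A_def by blast
    then have "A = truncation P (mdeg b)" using b by (rule polymatroid_bases_truncation)
    then show ?thesis
      using \<open>A \<noteq> {}\<close> P(1) unfolding polymatroid_or_stable_def truncation_def by blast
  next
    assume st: "(stable_ideal I \<or> strongly_stable_ideal I) \<and> equigenerated I"
    then obtain d where deg: "\<And>u. u \<in> A \<Longrightarrow> mdeg u = d"
      unfolding equigenerated_def A_def by blast
    have "stable_monomials A"
      unfolding stable_monomials_def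
    proof (intro ballI impI allI)
      fix u i assume u: "u \<in> A" "u \<noteq> 0" "i < Max (keys u)"
      have max: "Max (keys u) \<in> keys u" using u(2) by (intro Max_in) simp_all
      have "monomial u \<in> I" using u(1) up_superset[of A] by (auto simp: I)
      then have "monomial (u - single (Max (keys u)) 1 + single i 1) \<in> I"
        using st u(2,3) max unfolding stable_ideal_def strongly_stable_ideal_def by blast
      then have "u - single (Max (keys u)) 1 + single i 1 \<in> up A" by (simp add: I)
      moreover have "mdeg (u - single (Max (keys u)) 1 + single i 1) = d"
        using max deg[OF u(1)] mdeg_exchange[of u "Max (keys u)" i] by (simp add: in_keys_iff)
      ultimately show "u - single (Max (keys u)) 1 + single i 1 \<in> A"
        using up_equidegree(2)[OF deg] by blast
    qed
    then show ?thesis using \<open>A \<noteq> {}\<close> deg unfolding polymatroid_or_stable_def by blast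
  qed
  then obtain d where A: "polymatroid_or_stable d A" ..
  have d: "initial_degree I = d"
    using A by (intro initial_degree_equidegree[OF _ _ I]) (auto simp: polymatroid_or_stable_def)
  have "linear_resolution (iter_gradient l I) \<and> reg (iter_gradient l I) = int d - int l"
    if "l \<le> d" for l
  proof -
    have cls: "polymatroid_or_stable (d - l) ((monomial_gradient ^^ l) A)"
      and "iter_gradient l I = mon_span (up ((monomial_gradient ^^ l) A))"
      using iter_gradient_mon_span[OF A I assms(3) that] by simp_all
    then show ?thesis using polymatroid_or_stable_reg[OF cls, where 'a = 'a] that by (simp add: of_nat_diff)
  qed
  moreover have "homogeneous_ideal I"
    unfolding homogeneous_ideal_def I ideal_gen_monomials[symmetric]
    by (intro exI[of _ "monomial ` A"]) (auto simp: homogeneous_def)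
  ultimately show ?thesis unfolding differential_linear_resolution_def d by blast
qed

end
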